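(* Let $V$ be a free $R$-module of finite rank equipped with a symplectic form $\omega$ and let $n\ge0$. Then the affinoid Weyl algebra $K_\omega\langle V\rangle_n$ is a simple ring.
   Context: $R$ is a complete discrete valuation ring with uniformizer $\pi$, residue field $k$ and fraction field $K$ of characteristic $0$. An $R$-bilinear form $\omega:V\times V\to R$ is symplectic if its extensions $\omega_K$ to $V_K=K\otimes_RV$ and $\omega_k$ to $V_k=k\otimes_RV$ are non-degenerate alternating forms. $R_\omega[V]$ is the quotient of the tensor algebra of $V$ over $R$ by the relations $vw-wv=\omega(v,w)$ ($v,w\in V$), with the positive filtration having $R$ in degree $0$ and $V$ in degree $1$. For $n\ge0$, $R_\omega[V]_n:=\sum_{i\ge0}\pi^{in}F_iR_\omega[V]$ (the $R$-subalgebra of $R_\omega[V]\otimes_RK$ generated by $\pi^nV$), and $K_\omega\langle V\rangle_n:=(\varprojlim_a R_\omega[V]_n/\pi^aR_\omega[V]_n)\otimes_RK$. *)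

theory Defs
  imports "HOL-Algebra.Ideal"
begin

text \<open>K is a field of characteristic 0 (type class field_char_0); v is a discrete
  valuation on K (values of v at 0 are irrelevant), pi a uniformizer, and
  R = {x. x = 0 or v x >= 0} the valuation ring.  K is complete for v.\<close>

definition val_ring :: "('k::field \<Rightarrow> int) \<Rightarrow> 'k set" where
  "val_ring v = {x. x = 0 \<or> 0 \<le> v x}"

definition complete_dvr :: "('k::field \<Rightarrow> int) \<Rightarrow> 'k \<Rightarrow> bool" where
  "complete_dvr v \<pi> \<longleftrightarrow>
     (\<forall>x y. x \<noteq> 0 \<longrightarrow> y \<noteq> 0 \<longrightarrow> v (x * y) = v x + v y) \<and>
     (\<forall>x y. x \<noteq> 0 \<longrightarrow> y \<noteq> 0 \<longrightarrow> x + y \<noteq> 0 \<longrightarrow> min (v x) (v y) \<le> v (x + y)) \<and>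
     \<pi> \<noteq> 0 \<and> v \<pi> = 1 \<and>
     (\<forall>s::nat \<Rightarrow> 'k.
        (\<forall>N::int. \<exists>M. \<forall>m\<ge>M. \<forall>m'\<ge>M. s m - s m' = 0 \<or> N \<le> v (s m - s m')) \<longrightarrow>
        (\<exists>L. \<forall>N::int. \<exists>M. \<forall>m\<ge>M. s m - L = 0 \<or> N \<le> v (s m - L)))"

text \<open>V is free of rank d with basis e_0..e_(d-1); an R-bilinear form is given by its
  Gram matrix Omega (Omega i j = omega(e_i, e_j)).\<close>

definition bform :: "nat \<Rightarrow> (nat \<Rightarrow> nat \<Rightarrow> 'k::field) \<Rightarrow> (nat \<Rightarrow> 'k) \<Rightarrow> (nat \<Rightarrow> 'k) \<Rightarrow> 'k" where
  "bform d \<Omega> x y = (\<Sum>i<d. \<Sum>j<d. x i * \<Omega> i j * y j)"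

definition lattice_vecs :: "('k::field \<Rightarrow> int) \<Rightarrow> nat \<Rightarrow> (nat \<Rightarrow> 'k) set" where
  "lattice_vecs v d = {x. \<forall>i<d. x i \<in> val_ring v}"

definition symplectic :: "('k::field \<Rightarrow> int) \<Rightarrow> 'k \<Rightarrow> nat \<Rightarrow> (nat \<Rightarrow> nat \<Rightarrow> 'k) \<Rightarrow> bool" where
  "symplectic v \<pi> d \<Omega> \<longleftrightarrow>
     (\<forall>i<d. \<forall>j<d. \<Omega> i j \<in> val_ring v) \<and>
     \<comment> \<open>omega_K alternating and non-degenerate\<close>
     (\<forall>x. bform d \<Omega> x x = 0) \<and>
     (\<forall>x. (\<exists>i<d. x i \<noteq> 0) \<longrightarrow> (\<exists>y. bform d \<Omega> x y \<noteq> 0)) \<and>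
     \<comment> \<open>omega_k alternating and non-degenerate (reduction modulo pi)\<close>
     (\<forall>x\<in>lattice_vecs v d. bform d \<Omega> x x \<in> (\<lambda>r. \<pi> * r) ` val_ring v) \<and>
     (\<forall>x\<in>lattice_vecs v d. (\<exists>i<d. x i \<notin> (\<lambda>r. \<pi> * r) ` val_ring v) \<longrightarrow>
        (\<exists>y\<in>lattice_vecs v d. bform d \<Omega> x y \<notin> (\<lambda>r. \<pi> * r) ` val_ring v))"

type_synonym 'k fa = "nat list \<Rightarrow> 'k"

definition free_alg :: "nat \<Rightarrow> 'k::field fa set" where
  "free_alg d = {f. finite {w. f w \<noteq> 0} \<and> (\<forall>w. f w \<noteq> 0 \<longrightarrow> (\<forall>x\<in>set w. x < d))}"

definition fa_add :: "'k::field fa \<Rightarrow> 'k fa \<Rightarrow> 'k fa" where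
  "fa_add f g = (\<lambda>w. f w + g w)"

definition fa_diff :: "'k::field fa \<Rightarrow> 'k fa \<Rightarrow> 'k fa" where
  "fa_diff f g = (\<lambda>w. f w - g w)"

definition fa_mul :: "'k::field fa \<Rightarrow> 'k fa \<Rightarrow> 'k fa" where
  "fa_mul f g = (\<lambda>w. \<Sum>i\<in>{0..length w}. f (take i w) * g (drop i w))"

definition fa_smul :: "'k::field \<Rightarrow> 'k fa \<Rightarrow> 'k fa" where
  "fa_smul c f = (\<lambda>w. c * f w)"

definition fa_zero :: "'k::field fa" where
  "fa_zero = (\<lambda>w. 0)"

definition fa_one :: "'k::field fa" where
  "fa_one = (\<lambda>w. if w = [] then 1 else 0)"

definition fa_gen :: "nat \<Rightarrow> 'k::field fa" where
  "fa_gen i = (\<lambda>w. if w = [i] then 1 else 0)"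

definition weyl_rel :: "(nat \<Rightarrow> nat \<Rightarrow> 'k::field) \<Rightarrow> nat \<Rightarrow> nat \<Rightarrow> 'k fa" where
  "weyl_rel \<Omega> i j = fa_diff (fa_diff (fa_mul (fa_gen i) (fa_gen j)) (fa_mul (fa_gen j) (fa_gen i)))
                            (fa_smul (\<Omega> i j) fa_one)"

text \<open>Two-sided ideal of the free K-algebra generated by the Weyl relations.
  The quotient is R_omega[V] tensor_R K (localisation is exact).\<close>
inductive_set weyl_ideal :: "nat \<Rightarrow> (nat \<Rightarrow> nat \<Rightarrow> 'k::field) \<Rightarrow> 'k fa set"
  for d \<Omega> where
  zero: "fa_zero \<in> weyl_ideal d \<Omega>"
| gen: "\<lbrakk>a \<in> free_alg d; b \<in> free_alg d; i < d; j < d\<rbrakk>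
          \<Longrightarrow> fa_mul (fa_mul a (weyl_rel \<Omega> i j)) b \<in> weyl_ideal d \<Omega>"
| add: "\<lbrakk>x \<in> weyl_ideal d \<Omega>; y \<in> weyl_ideal d \<Omega>\<rbrakk> \<Longrightarrow> fa_add x y \<in> weyl_ideal d \<Omega>"

text \<open>Representatives (in the free algebra) of the R-subalgebra generated by pi^n V.\<close>
inductive_set lattice_gen :: "('k::field \<Rightarrow> int) \<Rightarrow> 'k \<Rightarrow> nat \<Rightarrow> nat \<Rightarrow> 'k fa set"
  for v \<pi> d n where
  scal: "r \<in> val_ring v \<Longrightarrow> fa_smul r fa_one \<in> lattice_gen v \<pi> d n"
| gen: "i < d \<Longrightarrow> fa_smul (\<pi> ^ n) (fa_gen i) \<in> lattice_gen v \<pi> d n"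
| add: "\<lbrakk>x \<in> lattice_gen v \<pi> d n; y \<in> lattice_gen v \<pi> d n\<rbrakk> \<Longrightarrow> fa_add x y \<in> lattice_gen v \<pi> d n"
| mul: "\<lbrakk>x \<in> lattice_gen v \<pi> d n; y \<in> lattice_gen v \<pi> d n\<rbrakk> \<Longrightarrow> fa_mul x y \<in> lattice_gen v \<pi> d n"

text \<open>Preimage in the free algebra of pi^a R_omega[V]_n  (a = 0 gives R_omega[V]_n itself).\<close>
definition lat_pow :: "('k::field \<Rightarrow> int) \<Rightarrow> 'k \<Rightarrow> nat \<Rightarrow> (nat \<Rightarrow> nat \<Rightarrow> 'k) \<Rightarrow> nat \<Rightarrow> nat \<Rightarrow> 'k fa set" where
  "lat_pow v \<pi> d \<Omega> n a =
     {fa_add (fa_smul (\<pi> ^ a) f) b | f b. f \<in> lattice_gen v \<pi> d n \<and> b \<in> weyl_ideal d \<Omega>}"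

text \<open>An element of the pi-adic completion lim_a L/pi^a L (L = R_omega[V]_n) is a
  compatible family of classes, given by representatives s a in L with
  s (a+1) = s a mod pi^a L.  Tensoring with K = R[1/pi] is localisation at pi:
  a pair (k, s) stands for pi^(-k) s.\<close>

type_synonym 'k aff_rep = "nat \<times> (nat \<Rightarrow> 'k fa)"

definition aff_valid :: "('k::field \<Rightarrow> int) \<Rightarrow> 'k \<Rightarrow> nat \<Rightarrow> (nat \<Rightarrow> nat \<Rightarrow> 'k) \<Rightarrow> nat \<Rightarrow> 'k aff_rep \<Rightarrow> bool" where
  "aff_valid v \<pi> d \<Omega> n p \<longleftrightarrow>
     (\<forall>a. snd p a \<in> lat_pow v \<pi> d \<Omega> n 0 \<and>
          fa_diff (snd p (Suc a)) (snd p a) \<in> lat_pow v \<pi> d \<Omega> n a)"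

definition aff_eq :: "('k::field \<Rightarrow> int) \<Rightarrow> 'k \<Rightarrow> nat \<Rightarrow> (nat \<Rightarrow> nat \<Rightarrow> 'k) \<Rightarrow> nat \<Rightarrow> 'k aff_rep \<Rightarrow> 'k aff_rep \<Rightarrow> bool" where
  "aff_eq v \<pi> d \<Omega> n p q \<longleftrightarrow>
     (\<exists>m. \<forall>a. fa_diff (fa_smul (\<pi> ^ (fst q + m)) (snd p a)) (fa_smul (\<pi> ^ (fst p + m)) (snd q a))
                \<in> lat_pow v \<pi> d \<Omega> n a)"

definition aff_addp :: "'k::field \<Rightarrow> 'k aff_rep \<Rightarrow> 'k aff_rep \<Rightarrow> 'k aff_rep" where
  "aff_addp \<pi> p q = (fst p + fst q,
      \<lambda>a. fa_add (fa_smul (\<pi> ^ fst q) (snd p a)) (fa_smul (\<pi> ^ fst p) (snd q a)))"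

definition aff_mulp :: "'k::field aff_rep \<Rightarrow> 'k aff_rep \<Rightarrow> 'k aff_rep" where
  "aff_mulp p q = (fst p + fst q, \<lambda>a. fa_mul (snd p a) (snd q a))"

definition aff_cls :: "('k::field \<Rightarrow> int) \<Rightarrow> 'k \<Rightarrow> nat \<Rightarrow> (nat \<Rightarrow> nat \<Rightarrow> 'k) \<Rightarrow> nat \<Rightarrow> 'k aff_rep \<Rightarrow> 'k aff_rep set" where
  "aff_cls v \<pi> d \<Omega> n p = {q. aff_valid v \<pi> d \<Omega> n q \<and> aff_eq v \<pi> d \<Omega> n q p}"

definition affinoid_weyl :: "('k::field \<Rightarrow> int) \<Rightarrow> 'k \<Rightarrow> nat \<Rightarrow> (nat \<Rightarrow> nat \<Rightarrow> 'k) \<Rightarrow> nat \<Rightarrow> ('k aff_rep set) ring" where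
  "affinoid_weyl v \<pi> d \<Omega> n =
     \<lparr>carrier = aff_cls v \<pi> d \<Omega> n ` {p. aff_valid v \<pi> d \<Omega> n p},
      monoid.mult = (\<lambda>X Y. {q. aff_valid v \<pi> d \<Omega> n q \<and>
                          (\<exists>x\<in>X. \<exists>y\<in>Y. aff_eq v \<pi> d \<Omega> n q (aff_mulp x y))}),
      one = aff_cls v \<pi> d \<Omega> n (0, \<lambda>a. fa_one),
      zero = aff_cls v \<pi> d \<Omega> n (0, \<lambda>a. fa_zero),
      add = (\<lambda>X Y. {q. aff_valid v \<pi> d \<Omega> n q \<and>
                          (\<exists>x\<in>X. \<exists>y\<in>Y. aff_eq v \<pi> d \<Omega> n q (aff_addp \<pi> x y))})\<rparr>"

definition simple_ring :: "('a, 'm) ring_scheme \<Rightarrow> bool" where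
  "simple_ring A \<longleftrightarrow> ring A \<and> \<zero>\<^bsub>A\<^esub> \<noteq> \<one>\<^bsub>A\<^esub> \<and>
     (\<forall>J. ideal J A \<longrightarrow> J = {\<zero>\<^bsub>A\<^esub>} \<or> J = carrier A)"

end

theory Submission
  imports Defs "HOL-Library.Function_Algebras" "HOL.Vector_Spaces"
begin

text \<open>
  Rescaling the basis by \<open>\<pi> ^ n\<close>, the lattice is generated by \<open>X\<^sub>0, \<dots>, X\<^sub>d\<^sub>-\<^sub>1\<close> with
  scalar commutators in R, hence is spanned over R by the ordered monomials. Nondegeneracy of the
  form over K gives elements \<open>y\<^sub>i\<close> for which \<open>ad y\<^sub>i\<close> is the partial derivative in \<open>X\<^sub>i\<close>; the divided
  powers \<open>(ad y\<^sub>i) ^ m / m!\<close> preserve the lattice, and they preserve every two-sided ideal since K has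
  characteristic 0. Scale a nonzero element of an ideal so that it lies in the completed lattice but
  not in its \<open>\<pi>\<close>-multiple; modulo \<open>\<pi>\<close> it is a nonempty combination of ordered monomials with unit
  coefficients. For each \<open>i\<close> in turn, the divided power of order the top \<open>X\<^sub>i\<close>-degree removes \<open>X\<^sub>i\<close>
  and keeps the combination nonempty. What remains is a unit of R modulo \<open>\<pi>\<close>, which a geometric
  series inverts. The ring is nonzero because the Weyl algebra acts on polynomials with
  \<open>X\<^sub>i\<close> acting as \<open>x\<^sub>i + (\<Sum>j<i. \<Omega> i j \<partial>\<^sub>j)\<close>, which preserves integrality.
\<close>

section \<open>The ring of noncommutative formal series\<close>

text \<open>All congruences are between elements of the free algebra over K: the preimage of each
  pi^a L contains the Weyl ideal, and inverting pi is mere scaling. The obstacle is positive residue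
  characteristic. There (ad y_i)^m sends X_i^m to m!, which may vanish modulo pi, so the division by
  m! is forced; but neither 1/m! nor y_i, whose coefficients are only known to lie in K, has to be
  integral. Integrality of the divided powers is therefore read off a Leibniz recursion on words
  whose coefficients are 0 and 1, while stability of ideals is seen after pi is inverted, where y_i
  and 1/m! are bounded elements. The combination modulo pi is nonempty at the start because the
  scale is exact: an empty one would leave the element in the pi-multiple. It stays nonempty because
  ordered words with equally many X_i remain distinct when X_i is deleted, so that unit coefficients
  are never added up.\<close>

typedef (overloaded) 'k ncs = "UNIV :: ('k::field fa) set"
  morphisms nc_coeff Nc by simp

lemmas nc_inject = nc_coeff_inject[symmetric]

lemma nc_coeff_Nc [simp]: "nc_coeff (Nc f) = f"
  by (simp add: Nc_inverse)

text \<open>Both sides sum over the cuts of a word into three consecutive pieces. The position of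
  the second cut is counted from the start of the word on the left, from the first cut on the
  right.\<close>

lemma fa_mul_assoc: "fa_mul (fa_mul f g) h = fa_mul f (fa_mul g h)"
proof
  fix w :: "nat list"
  define n where "n = length w"
  define t where "t j i = f (take j w) * g (drop j (take i w)) * h (drop i w)" for j i
  have "fa_mul (fa_mul f g) h w = (\<Sum>i\<in>{0..n}. \<Sum>j\<in>{0..i}. t j i)"
    unfolding fa_mul_def n_def t_def
    by (intro sum.cong refl) (auto simp: sum_distrib_right min_def intro!: sum.cong)
  also have "\<dots> = (\<Sum>(i,j)\<in>Sigma {0..n} (\<lambda>i. {0..i}). t j i)"
    by (subst sum.Sigma) auto
  also have "\<dots> = (\<Sum>(j,i)\<in>Sigma {0..n} (\<lambda>j. {0..n-j}). t j (j + i))"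
    by (rule sum.reindex_bij_witness[where i="\<lambda>(j,i). (j+i,j)" and j="\<lambda>(i,j). (j,i-j)"]) auto
  also have "\<dots> = (\<Sum>j\<in>{0..n}. \<Sum>i\<in>{0..n-j}. t j (j + i))"
    by (subst sum.Sigma) auto
  also have "\<dots> = fa_mul f (fa_mul g h) w"
    unfolding fa_mul_def n_def t_def
    by (intro sum.cong refl) (simp add: sum_distrib_left drop_take mult.assoc add.commute)
  finally show "fa_mul (fa_mul f g) h w = fa_mul f (fa_mul g h) w" .
qed

lemma fa_mul_smul_one_left: "fa_mul (fa_smul c fa_one) f = fa_smul c f"
proof
  fix w
  have "fa_mul (fa_smul c fa_one) f w = (\<Sum>i\<in>{0..length w}. if i = 0 then c * f w else 0)"
    unfolding fa_mul_def fa_smul_def fa_one_def by (intro sum.cong refl) auto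
  then show "fa_mul (fa_smul c fa_one) f w = fa_smul c f w"
    by (simp add: fa_smul_def)
qed

lemma fa_mul_smul_one_right: "fa_mul f (fa_smul c fa_one) = fa_smul c f"
proof
  fix w
  have "fa_mul f (fa_smul c fa_one) w = (\<Sum>i\<in>{0..length w}. if i = length w then c * f w else 0)"
    unfolding fa_mul_def fa_smul_def fa_one_def by (intro sum.cong refl) auto
  then show "fa_mul f (fa_smul c fa_one) w = fa_smul c f w"
    by (simp add: fa_smul_def)
qed

lemma fa_smul_1 [simp]: "fa_smul 1 f = f"
  by (simp add: fa_smul_def)

text \<open>Finite support is left out of the type: the product at a word is a finite sum over its
  splittings, so all functions on words form a ring. Finiteness comes back through
  \<open>free_ncs\<close>.\<close>

instantiation ncs :: (field) ring_1
begin

definition zero_ncs :: "'a ncs" where "zero_ncs = Nc fa_zero"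
definition one_ncs :: "'a ncs" where "one_ncs = Nc fa_one"
definition plus_ncs :: "'a ncs \<Rightarrow> 'a ncs \<Rightarrow> 'a ncs" where
  "plus_ncs x y = Nc (fa_add (nc_coeff x) (nc_coeff y))"
definition minus_ncs :: "'a ncs \<Rightarrow> 'a ncs \<Rightarrow> 'a ncs" where
  "minus_ncs x y = Nc (fa_diff (nc_coeff x) (nc_coeff y))"
definition uminus_ncs :: "'a ncs \<Rightarrow> 'a ncs" where
  "uminus_ncs x = Nc (fa_diff fa_zero (nc_coeff x))"
definition times_ncs :: "'a ncs \<Rightarrow> 'a ncs \<Rightarrow> 'a ncs" where
  "times_ncs x y = Nc (fa_mul (nc_coeff x) (nc_coeff y))"

lemmas ncs_defs = zero_ncs_def one_ncs_def plus_ncs_def minus_ncs_def uminus_ncs_def times_ncs_def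

instance
proof
  fix x y z :: "'a ncs"
  show "x + y + z = x + (y + z)" "x + y = y + x" "0 + x = x" "- x + x = 0" "x - y = x + - y"
    by (simp_all add: ncs_defs nc_inject fa_add_def fa_diff_def fa_zero_def algebra_simps)
  show "x * y * z = x * (y * z)"
    by (simp add: ncs_defs fa_mul_assoc)
  show "1 * x = x" "x * 1 = x"
    using fa_mul_smul_one_left[of 1 "nc_coeff x"] fa_mul_smul_one_right[of "nc_coeff x" 1]
    by (simp_all add: ncs_defs nc_inject)
  show "(x + y) * z = x * z + y * z" "x * (y + z) = x * y + x * z"
    by (simp_all add: ncs_defs nc_inject fa_add_def fa_mul_def algebra_simps sum.distrib)
  show "(0::'a ncs) \<noteq> 1"
    by (auto simp: ncs_defs nc_inject fa_zero_def fa_one_def fun_eq_iff)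
qed

end

lemma nc_coeff_simps:
  "nc_coeff 0 = fa_zero" "nc_coeff 1 = fa_one"
  "nc_coeff (x + y) = fa_add (nc_coeff x) (nc_coeff y)"
  "nc_coeff (x - y) = fa_diff (nc_coeff x) (nc_coeff y)"
  by (simp_all add: ncs_defs)

lemma nc_coeff_mult: "nc_coeff (x * y) = fa_mul (nc_coeff x) (nc_coeff y)"
  by (simp add: ncs_defs)

definition nc_const :: "'k::field \<Rightarrow> 'k ncs" where
  "nc_const c = Nc (fa_smul c fa_one)"

definition nc_word :: "nat list \<Rightarrow> 'k::field ncs" where
  "nc_word w = Nc (\<lambda>u. if u = w then 1 else 0)"

lemma nc_coeff_const_mult [simp]: "nc_coeff (nc_const c * x) = fa_smul c (nc_coeff x)"
  by (simp add: nc_const_def ncs_defs fa_mul_smul_one_left)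

lemma nc_const_commute: "x * nc_const c = nc_const c * x"
  by (simp add: nc_const_def ncs_defs fa_mul_smul_one_left fa_mul_smul_one_right)

lemma nc_const_mult: "nc_const (a * b) = nc_const a * nc_const b"
  by (simp add: nc_inject) (simp add: nc_const_def fa_smul_def mult.assoc)

lemma nc_const_add: "nc_const (a + b) = nc_const a + nc_const b"
  by (simp add: nc_const_def ncs_defs nc_inject fa_smul_def fa_add_def algebra_simps)

lemma nc_const_1 [simp]: "nc_const 1 = 1"
  by (simp add: nc_const_def one_ncs_def)

lemma fa_mul_word_append:
  "fa_mul (\<lambda>x. if x = u then 1 else 0) (\<lambda>x. if x = w then 1 else 0)
     = (\<lambda>x. if x = u @ w then 1 else (0::'k::field))"
proof
  fix x :: "nat list"
  have "(\<Sum>i\<in>{0..length x}. (if take i x = u then 1 else 0) * (if drop i x = w then 1 else (0::'k)))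
      = (\<Sum>i\<in>{0..length x}. if i = length u then (if x = u @ w then 1 else 0) else 0)"
  proof (intro sum.cong refl)
    fix i assume "i \<in> {0..length x}"
    then have "take i x = u \<and> drop i x = w \<longleftrightarrow> i = length u \<and> x = u @ w"
      by (metis append_eq_conv_conj append_take_drop_id atLeastAtMost_iff length_take min.absorb2)
    then show "(if take i x = u then 1 else 0) * (if drop i x = w then 1 else (0::'k))
        = (if i = length u then (if x = u @ w then 1 else 0) else 0)"
      by (cases "take i x = u"; cases "drop i x = w") auto
  qed
  also have "\<dots> = (if x = u @ w then 1 else 0)"
    by auto
  finally show "fa_mul (\<lambda>x. if x = u then 1 else 0) (\<lambda>x. if x = w then 1 else 0) x
      = (if x = u @ w then 1 else (0::'k))"
    by (simp add: fa_mul_def)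
qed

lemma nc_word_append: "nc_word (u @ w) = (nc_word u * nc_word w :: 'k::field ncs)"
  by (simp add: nc_word_def ncs_defs fa_mul_word_append)

lemma nc_word_Nil [simp]: "nc_word [] = 1"
  by (simp add: nc_word_def one_ncs_def fa_one_def)

lemma nc_word_single: "nc_word [i] = Nc (fa_gen i)"
  by (simp add: nc_word_def fa_gen_def)

section \<open>Completion of a filtered algebra\<close>

text \<open>\<open>P a\<close> stands for the preimage of \<open>\<pi>^a L\<close>, where L is a lattice in a quotient of the algebra.
  The completion with \<open>\<pi>\<close> inverted is \<open>Cseq\<close> modulo \<open>Zseq\<close> below, with pointwise operations.\<close>

locale pi_filtration =
  fixes sc :: "'k::field \<Rightarrow> 'a::ring_1" and \<pi> :: 'k and P :: "nat \<Rightarrow> 'a set"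
  assumes sc_mult: "sc (c * d) = sc c * sc d"
    and sc_1: "sc 1 = 1"
    and sc_commute: "x * sc c = sc c * x"
    and sc_bounded: "\<exists>k. sc (\<pi> ^ k * c) \<in> P 0"
    and pi_nonzero: "\<pi> \<noteq> 0"
    and P_zero: "0 \<in> P a"
    and P_diff: "\<lbrakk>x \<in> P a; y \<in> P a\<rbrakk> \<Longrightarrow> x - y \<in> P a"
    and P_mult: "\<lbrakk>x \<in> P a; y \<in> P b\<rbrakk> \<Longrightarrow> x * y \<in> P (a + b)"
    and P_one: "1 \<in> P 0"
    and P_shift: "sc (\<pi> ^ m) * x \<in> P (a + m) \<longleftrightarrow> x \<in> P a"
    and P_Suc: "x \<in> P (Suc a) \<Longrightarrow> x \<in> P a"
begin

lemma P_antimono: "a \<le> b \<Longrightarrow> x \<in> P b \<Longrightarrow> x \<in> P a"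
  by (induction rule: dec_induct) (auto dest: P_Suc)

lemma P_uminus: "x \<in> P a \<Longrightarrow> - x \<in> P a"
  using P_diff[OF P_zero, of x a] by simp

lemma P_add: "x \<in> P a \<Longrightarrow> y \<in> P a \<Longrightarrow> x + y \<in> P a"
  using P_diff[OF _ P_uminus, of x a y] by simp

lemma P_mult0: "x \<in> P a \<Longrightarrow> y \<in> P 0 \<Longrightarrow> x * y \<in> P a" "y \<in> P 0 \<Longrightarrow> x \<in> P a \<Longrightarrow> y * x \<in> P a"
  using P_mult[of x a y 0] P_mult[of y 0 x a] by simp_all

lemma P_scale: "x \<in> P a \<Longrightarrow> sc (\<pi> ^ m) * x \<in> P a"
  using P_shift[of m x a] P_antimono[of a "a + m"] by auto

lemma sc_inverse: "c \<noteq> 0 \<Longrightarrow> sc c * (sc (inverse c) * x) = x" "c \<noteq> 0 \<Longrightarrow> sc (inverse c) * (sc c * x) = x"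
  by (simp_all add: mult.assoc[symmetric] sc_mult[symmetric] sc_1)

lemma P_unscale_iff: "sc (inverse (\<pi> ^ m)) * x \<in> P a \<longleftrightarrow> x \<in> P (a + m)"
  using P_shift[of m "sc (inverse (\<pi> ^ m)) * x" a] pi_nonzero by (simp add: sc_inverse)

text \<open>\<open>k\<close> is a common denominator: after multiplication by
  \<open>\<pi> ^ k\<close> the sequence is a compatible family of representatives for the inverse
  limit, the terms \<open>a\<close> and \<open>Suc a\<close> agreeing modulo \<open>P a\<close>. In
  the same way \<open>nseq\<close> describes the families that represent zero.\<close>

definition bseq :: "nat \<Rightarrow> (nat \<Rightarrow> 'a) \<Rightarrow> bool" where
  "bseq k u \<longleftrightarrow> (\<forall>a. sc (\<pi> ^ k) * u a \<in> P 0 \<and> sc (\<pi> ^ k) * (u (Suc a) - u a) \<in> P a)"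

definition nseq :: "nat \<Rightarrow> (nat \<Rightarrow> 'a) \<Rightarrow> bool" where
  "nseq k u \<longleftrightarrow> (\<forall>a. sc (\<pi> ^ k) * u a \<in> P a)"

definition Cseq :: "(nat \<Rightarrow> 'a) set" where "Cseq = {u. \<exists>k. bseq k u}"

definition Zseq :: "(nat \<Rightarrow> 'a) set" where "Zseq = {u. \<exists>k. nseq k u}"

lemma sc_pi_add: "sc (\<pi> ^ (k + l)) * x = sc (\<pi> ^ l) * (sc (\<pi> ^ k) * x)"
  by (metis add.commute mult.assoc power_add sc_mult)

lemma bseq_mono: "bseq k u \<Longrightarrow> k \<le> l \<Longrightarrow> bseq l u"
  unfolding bseq_def by (metis P_scale le_add_diff_inverse sc_pi_add)

lemma nseq_mono: "nseq k u \<Longrightarrow> k \<le> l \<Longrightarrow> nseq l u"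
  unfolding nseq_def by (metis P_scale le_add_diff_inverse sc_pi_add)

lemma bseq_common:
  assumes "u \<in> Cseq" "w \<in> Cseq"
  obtains k where "bseq k u" "bseq k w"
proof -
  obtain k l where "bseq k u" "bseq l w" using assms by (auto simp: Cseq_def)
  then have "bseq (max k l) u" "bseq (max k l) w" by (auto intro: bseq_mono)
  then show thesis by (rule that)
qed

lemma nseq_common:
  assumes "u \<in> Zseq" "w \<in> Zseq"
  obtains k where "nseq k u" "nseq k w"
proof -
  obtain k l where "nseq k u" "nseq l w" using assms by (auto simp: Zseq_def)
  then have "nseq (max k l) u" "nseq (max k l) w" by (auto intro: nseq_mono)
  then show thesis by (rule that)
qed

lemma bseq_diff: "bseq k u \<Longrightarrow> bseq k w \<Longrightarrow> bseq k (u - w)"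
proof -
  assume u: "bseq k u" and w: "bseq k w"
  have "sc (\<pi> ^ k) * ((u - w) (Suc a) - (u - w) a)
      = sc (\<pi> ^ k) * (u (Suc a) - u a) - sc (\<pi> ^ k) * (w (Suc a) - w a)" for a
    by (simp add: algebra_simps)
  moreover have "sc (\<pi> ^ k) * (u - w) a = sc (\<pi> ^ k) * u a - sc (\<pi> ^ k) * w a" for a
    by (simp add: algebra_simps)
  ultimately show ?thesis using u w unfolding bseq_def by (metis P_diff)
qed

lemma sc_mult_both: "sc (\<pi> ^ (k + l)) * (x * y) = (sc (\<pi> ^ k) * x) * (sc (\<pi> ^ l) * y)"
  by (metis mult.assoc power_add sc_commute sc_mult)

lemma bseq_mult:
  assumes u: "bseq k u" and w: "bseq l w" shows "bseq (k + l) (u * w)"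
proof -
  have "sc (\<pi> ^ (k + l)) * (u * w) a \<in> P 0" for a
    using P_mult[of "sc (\<pi> ^ k) * u a" 0 "sc (\<pi> ^ l) * w a" 0] u w
    by (simp add: bseq_def sc_mult_both)
  moreover have "sc (\<pi> ^ (k + l)) * ((u * w) (Suc a) - (u * w) a) \<in> P a" for a
  proof -
    have "(u * w) (Suc a) - (u * w) a = u (Suc a) * (w (Suc a) - w a) + (u (Suc a) - u a) * w a"
      by (simp add: algebra_simps)
    then have "sc (\<pi> ^ (k + l)) * ((u * w) (Suc a) - (u * w) a)
       = (sc (\<pi> ^ k) * u (Suc a)) * (sc (\<pi> ^ l) * (w (Suc a) - w a))
         + (sc (\<pi> ^ k) * (u (Suc a) - u a)) * (sc (\<pi> ^ l) * w a)"
      by (simp only: distrib_left sc_mult_both)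
    moreover have "sc (\<pi> ^ k) * u (Suc a) \<in> P 0" "sc (\<pi> ^ l) * (w (Suc a) - w a) \<in> P a"
      "sc (\<pi> ^ k) * (u (Suc a) - u a) \<in> P a" "sc (\<pi> ^ l) * w a \<in> P 0"
      using u w by (auto simp: bseq_def)
    ultimately show ?thesis by (simp only: P_add P_mult0)
  qed
  ultimately show ?thesis by (simp add: bseq_def)
qed

lemma bseq_const: "sc (\<pi> ^ k) * x \<in> P 0 \<Longrightarrow> bseq k (\<lambda>_. x)"
  by (simp add: bseq_def P_zero)

lemma Cseq_const: "sc (\<pi> ^ k) * x \<in> P 0 \<Longrightarrow> (\<lambda>_. x) \<in> Cseq"
  using bseq_const by (auto simp: Cseq_def)

lemma Cseq_sc: "(\<lambda>_. sc c) \<in> Cseq"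
  using sc_bounded[of c] by (auto simp: sc_mult intro: Cseq_const)

lemma Cseq_0: "0 \<in> Cseq"
  using Cseq_const[of 0 0] by (simp add: P_zero zero_fun_def)

lemma Cseq_1: "1 \<in> Cseq"
  using Cseq_const[of 0 1] by (simp add: P_one sc_1 one_fun_def)

lemma Cseq_diff: "u \<in> Cseq \<Longrightarrow> w \<in> Cseq \<Longrightarrow> u - w \<in> Cseq"
  by (metis (mono_tags) Cseq_def bseq_common bseq_diff mem_Collect_eq)

lemma Cseq_uminus: "u \<in> Cseq \<Longrightarrow> - u \<in> Cseq"
  using Cseq_diff[OF Cseq_0] by simp

lemma Cseq_add: "u \<in> Cseq \<Longrightarrow> w \<in> Cseq \<Longrightarrow> u + w \<in> Cseq"
  using Cseq_diff[OF _ Cseq_uminus, of u w] by simp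

lemma Cseq_mult: "u \<in> Cseq \<Longrightarrow> w \<in> Cseq \<Longrightarrow> u * w \<in> Cseq"
  using bseq_mult by (fastforce simp: Cseq_def)

lemma Zseq_0: "0 \<in> Zseq"
  by (auto simp: Zseq_def nseq_def P_zero)

lemma Zseq_diff: "u \<in> Zseq \<Longrightarrow> w \<in> Zseq \<Longrightarrow> u - w \<in> Zseq"
  by (erule (1) nseq_common) (auto simp: Zseq_def nseq_def right_diff_distrib intro: P_diff)

lemma Zseq_uminus: "u \<in> Zseq \<Longrightarrow> - u \<in> Zseq"
  using Zseq_diff[OF Zseq_0] by simp

lemma Zseq_add: "u \<in> Zseq \<Longrightarrow> w \<in> Zseq \<Longrightarrow> u + w \<in> Zseq"
  using Zseq_diff[OF _ Zseq_uminus, of u w] by simp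

lemma Zseq_mult:
  assumes "u \<in> Cseq" "z \<in> Zseq" shows "u * z \<in> Zseq" "z * u \<in> Zseq"
proof -
  obtain k l where "bseq k u" "nseq l z" using assms by (auto simp: Cseq_def Zseq_def)
  then have "nseq (k + l) (u * z)" "nseq (l + k) (z * u)"
    by (auto simp: nseq_def bseq_def sc_mult_both intro: P_mult0)
  then show "u * z \<in> Zseq" "z * u \<in> Zseq" by (auto simp: Zseq_def)
qed

lemma Zseq_subset_Cseq:
  assumes "z \<in> Zseq" shows "z \<in> Cseq"
proof -
  obtain k where z: "nseq k z" using assms by (auto simp: Zseq_def)
  have "sc (\<pi> ^ k) * (z (Suc a) - z a) \<in> P a" for a
    using z unfolding nseq_def right_diff_distrib by (blast intro: P_diff P_Suc)
  moreover have "sc (\<pi> ^ k) * z a \<in> P 0" for a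
    using z by (auto simp: nseq_def intro: P_antimono[of 0 a])
  ultimately show ?thesis by (auto simp: Cseq_def bseq_def)
qed

lemma bseq_tail:
  assumes "bseq 0 u" shows "u (b + a) - u a \<in> P a"
proof (induction b)
  case (Suc b)
  have "u (Suc (b + a)) - u (b + a) \<in> P a"
    using assms P_antimono[of a "b + a"] by (simp add: bseq_def sc_1)
  from P_add[OF this Suc] show ?case by simp
qed (simp add: P_zero)

text \<open>Some integral multiple \<open>w\<close> of \<open>u\<close> has a term
  \<open>w a\<close> outside \<open>P a\<close>. Later terms agree with \<open>w a\<close> modulo
  \<open>P a\<close>, so the exact power of \<open>\<pi>\<close> dividing \<open>w a\<close>, whose
  exponent is below \<open>a\<close>, serves for the whole tail and can be divided out.\<close>

lemma normalise:
  assumes "u \<in> Cseq" "u \<notin> Zseq"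
  obtains c u' f where "bseq 0 u'" "u' - (\<lambda>_. sc c) * u \<in> Zseq"
    "f \<in> P 0" "f \<notin> P 1" "\<And>b. u' b - f \<in> P 1"
proof -
  obtain k where k: "bseq k u" using assms by (auto simp: Cseq_def)
  define w where "w a = sc (\<pi> ^ k) * u a" for a
  have w: "bseq 0 w" using k by (simp add: bseq_def w_def sc_1 right_diff_distrib)
  have "\<not> nseq k u" using assms by (auto simp: Zseq_def)
  then obtain a where a: "w a \<notin> P a" by (auto simp: nseq_def w_def)
  define j where "j = (LEAST i. w a \<notin> P (Suc i))"
  have w0: "w a \<in> P 0" using w by (auto simp: bseq_def sc_1)
  have "a \<noteq> 0" using a w0 by metis
  then have a': "w a \<notin> P (Suc (a - 1))" using a by simp
  then have j1: "w a \<notin> P (Suc j)" unfolding j_def by (rule LeastI)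
  have j2: "w a \<in> P j"
    using w0 not_less_Least[of "j - 1" "\<lambda>i. w a \<notin> P (Suc i)"] unfolding j_def[symmetric]
    by (cases j) auto
  have ja: "Suc j \<le> a"
    using Least_le[of "\<lambda>i. w a \<notin> P (Suc i)", OF a'] \<open>a \<noteq> 0\<close> unfolding j_def[symmetric] by linarith
  define c where "c = inverse (\<pi> ^ j) * \<pi> ^ k"
  \<comment> \<open>The shift by \<open>a\<close> pays for the division: consecutive differences of
    \<open>w\<close> at \<open>b + a\<close> lie in \<open>P (b + a)\<close>, hence in
    \<open>P (b + j)\<close>, and after division by \<open>\<pi> ^ j\<close> in
    \<open>P b\<close>.\<close>
  define u' where "u' b = sc (inverse (\<pi> ^ j)) * w (b + a)" for b
  define f where "f = sc (inverse (\<pi> ^ j)) * w a"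
  show thesis
  proof
    have tail: "w (b + a) - w a \<in> P (Suc j)" for b
      using bseq_tail[OF w, of b a] P_antimono[OF ja] by blast
    show f1: "f \<notin> P 1" and f0: "f \<in> P 0"
      using j1 j2 by (auto simp: f_def P_unscale_iff)
    show d: "u' b - f \<in> P 1" for b
      using tail[of b] by (simp add: u'_def f_def right_diff_distrib[symmetric] P_unscale_iff)
    have "u' b \<in> P 0" for b
      using P_add[OF P_Suc[of _ 0] f0, of "u' b - f"] d[of b] by simp
    moreover have "u' (Suc b) - u' b \<in> P b" for b
      using w P_antimono[of "b + j" "b + a" "w (Suc (b + a)) - w (b + a)"] ja
      by (simp add: u'_def right_diff_distrib[symmetric] P_unscale_iff bseq_def sc_1)
    ultimately show "bseq 0 u'" by (simp add: bseq_def sc_1)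
    have "(u' - (\<lambda>_. sc c) * u) b = sc (inverse (\<pi> ^ j)) * (w (a + b) - w b)" for b
      by (simp add: u'_def c_def w_def sc_mult right_diff_distrib mult.assoc add.commute)
    then have "nseq j (u' - (\<lambda>_. sc c) * u)"
      unfolding nseq_def using pi_nonzero bseq_tail[OF w] by (simp add: sc_inverse)
    then show "u' - (\<lambda>_. sc c) * u \<in> Zseq" by (auto simp: Zseq_def)
  qed
qed

lemma geometric_left: "(\<Sum>i<b. h ^ i) * (1 - h) = 1 - (h :: 'a) ^ b"
proof (induction b)
  case (Suc b)
  have "(\<Sum>i<Suc b. h ^ i) * (1 - h) = (\<Sum>i<b. h ^ i) * (1 - h) + h ^ b * (1 - h)"
    by (simp add: distrib_right)
  also have "\<dots> = 1 - h ^ Suc b"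
    by (simp only: Suc) (simp add: right_diff_distrib power_commutes)
  finally show ?case .
qed simp

text \<open>Up to the scalar \<open>c\<close>, the sequence \<open>w\<close> is 1 - h with every
  term of \<open>h\<close> in \<open>P 1\<close>, so a geometric series inverts it from the left
  modulo null sequences.\<close>

lemma one_mem_if_unit_mod_P1:
  assumes J_sub: "J \<subseteq> Cseq" and ZJ: "Zseq \<subseteq> J"
    and J_add: "\<And>x y. x \<in> J \<Longrightarrow> y \<in> J \<Longrightarrow> x + y \<in> J"
    and J_mult: "\<And>x y. x \<in> Cseq \<Longrightarrow> y \<in> J \<Longrightarrow> x * y \<in> J"
    and w: "w \<in> J" "bseq 0 w" "\<And>b. w b - sc c \<in> P 1"
    and c: "c \<noteq> 0" "sc (inverse c) \<in> P 0"
  shows "1 \<in> J"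
proof -
  define h where "h b = 1 - sc (inverse c) * w b" for b
  have h1: "h b \<in> P 1" for b
  proof -
    have "h b = - (sc (inverse c) * (w b - sc c))"
      using c by (simp add: h_def right_diff_distrib sc_mult[symmetric] sc_1)
    then show ?thesis using P_uminus[OF P_mult0(2)[OF c(2) w(3)]] by simp
  qed
  have hd: "h (Suc b) - h b \<in> P b" for b
  proof -
    have "h (Suc b) - h b = - (sc (inverse c) * (w (Suc b) - w b))"
      by (simp add: h_def right_diff_distrib)
    moreover have "w (Suc b) - w b \<in> P b" using w(2) by (simp add: bseq_def sc_1)
    ultimately show ?thesis using P_uminus[OF P_mult0(2)[OF c(2)]] by simp
  qed
  have hp: "h b ^ i \<in> P i" for b i
  proof (induction i)
    case (Suc i)
    then show ?case using P_mult[OF h1 Suc, of b] by simp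
  qed (simp add: P_one)
  have hp0: "h b ^ i \<in> P 0" for b i using hp P_antimono[of 0 i] by blast
  have hpd: "h (Suc b) ^ i - h b ^ i \<in> P b" for b i
  proof (induction i)
    case (Suc i)
    have "h (Suc b) ^ Suc i - h b ^ Suc i
        = h (Suc b) * (h (Suc b) ^ i - h b ^ i) + (h (Suc b) - h b) * h b ^ i"
      by (simp add: algebra_simps)
    then show ?case
      using P_add[OF P_mult0(2)[OF P_Suc[of _ 0] Suc] P_mult0(1)[OF hd hp0]] h1 by simp
  qed (simp add: P_zero)
  \<comment> \<open>A diagonal truncation: the number of summands grows with the index, so the
    remainder \<open>h b ^ b\<close> lies in \<open>P b\<close> and is null. Passing from
    \<open>b\<close> to \<open>Suc b\<close> changes the old summands by elements of
    \<open>P b\<close> and adds one new summand in \<open>P b\<close>.\<close>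
  define g where "g b = (\<Sum>i<b. h b ^ i)" for b
  have P_sum: "(\<And>i. i < m \<Longrightarrow> F i \<in> P a) \<Longrightarrow> (\<Sum>i<m. F i) \<in> P a" for F and m a :: nat
    by (induction m) (auto simp: P_zero intro: P_add)
  have "g b \<in> P 0" for b unfolding g_def by (rule P_sum) (rule hp0)
  moreover have "g (Suc b) - g b \<in> P b" for b
  proof -
    have "g (Suc b) - g b = (\<Sum>i<b. h (Suc b) ^ i - h b ^ i) + h (Suc b) ^ b"
      by (simp add: g_def sum_subtractf)
    then show ?thesis using P_add[OF P_sum hp] hpd by simp
  qed
  ultimately have "bseq 0 g" by (simp add: bseq_def sc_1)
  then have gC: "g * (\<lambda>_. sc (inverse c)) \<in> Cseq"
    by (intro Cseq_mult Cseq_sc) (auto simp: Cseq_def)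
  have "1 - g * (\<lambda>_. sc (inverse c)) * w = (\<lambda>b. h b ^ b)"
  proof
    fix b
    have "(g * (\<lambda>_. sc (inverse c)) * w) b = g b * (1 - h b)"
      by (simp add: h_def mult.assoc)
    then show "(1 - g * (\<lambda>_. sc (inverse c)) * w) b = h b ^ b"
      by (simp add: g_def geometric_left)
  qed
  moreover have "nseq 0 (\<lambda>b. h b ^ b)" by (simp add: nseq_def sc_1 hp)
  ultimately have "1 - g * (\<lambda>_. sc (inverse c)) * w \<in> J" using ZJ by (auto simp: Zseq_def)
  from J_add[OF this J_mult[OF gC w(1)]] show ?thesis by simp
qed

end

section \<open>The valuation ring and the lattice filtration\<close>

locale dvr =
  fixes v :: "'k::field_char_0 \<Rightarrow> int" and \<pi> :: 'k
  assumes dvr: "complete_dvr v \<pi>"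
begin

lemma v_mult: "x \<noteq> 0 \<Longrightarrow> y \<noteq> 0 \<Longrightarrow> v (x * y) = v x + v y"
  and v_add: "x \<noteq> 0 \<Longrightarrow> y \<noteq> 0 \<Longrightarrow> x + y \<noteq> 0 \<Longrightarrow> min (v x) (v y) \<le> v (x + y)"
  and pi_nonzero: "\<pi> \<noteq> 0" and v_pi: "v \<pi> = 1"
  using dvr by (auto simp: complete_dvr_def)

lemma v_1: "v 1 = 0"
  using v_mult[of 1 1] by simp

lemma v_m1: "v (- 1) = 0"
  using v_mult[of "-1" "-1"] v_1 by simp

lemma v_inverse: "x \<noteq> 0 \<Longrightarrow> v (inverse x) = - v x"
  using v_mult[of x "inverse x"] v_1 by simp

lemma R_mult: "x \<in> val_ring v \<Longrightarrow> y \<in> val_ring v \<Longrightarrow> x * y \<in> val_ring v"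
  by (cases "x = 0"; cases "y = 0") (auto simp: val_ring_def v_mult)

lemma R_add: "x \<in> val_ring v \<Longrightarrow> y \<in> val_ring v \<Longrightarrow> x + y \<in> val_ring v"
  using v_add[of x y] by (cases "x = 0"; cases "y = 0"; cases "x + y = 0") (auto simp: val_ring_def)

lemma R_0: "0 \<in> val_ring v" and R_1: "1 \<in> val_ring v" and R_m1: "- 1 \<in> val_ring v"
  by (auto simp: val_ring_def v_1 v_m1)

lemma R_of_nat: "of_nat m \<in> val_ring v"
  by (induction m) (auto intro: R_0 R_1 R_add)

lemma R_pi: "\<pi> \<in> val_ring v"
  by (simp add: val_ring_def v_pi)

lemma R_power: "x \<in> val_ring v \<Longrightarrow> x ^ m \<in> val_ring v"
  by (induction m) (auto intro: R_1 R_mult)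

lemma R_sum: "(\<And>i. i \<in> I \<Longrightarrow> f i \<in> val_ring v) \<Longrightarrow> sum f I \<in> val_ring v"
  by (induction I rule: infinite_finite_induct) (auto intro: R_0 R_add)

lemma v_pi_power: "v (\<pi> ^ m) = int m"
  by (induction m) (auto simp: v_1 v_mult pi_nonzero v_pi)

lemma R_bounded: "\<exists>m. \<pi> ^ m * c \<in> val_ring v"
proof (cases "c = 0")
  case False
  then have "\<pi> ^ nat (- v c) * c \<in> val_ring v"
    by (simp add: val_ring_def v_mult pi_nonzero v_pi_power)
  then show ?thesis ..
qed (simp add: R_0)

lemma R_nonunit: "c \<in> val_ring v \<Longrightarrow> \<not> (c \<noteq> 0 \<and> v c = 0) \<Longrightarrow> inverse \<pi> * c \<in> val_ring v"
  by (cases "c = 0") (auto simp: val_ring_def v_mult pi_nonzero v_inverse v_pi)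

lemma R_unit_inverse: "c \<noteq> 0 \<Longrightarrow> v c = 0 \<Longrightarrow> inverse c \<in> val_ring v"
  by (simp add: val_ring_def v_inverse)

lemma inverse_pi_notin_R: "inverse \<pi> \<notin> val_ring v"
  by (simp add: val_ring_def v_inverse pi_nonzero v_pi)

end

text \<open>Carries inductions over \<open>weyl_ideal\<close> and \<open>lattice_gen\<close>, which
  are sets of functions, over to the type \<open>ncs\<close>.\<close>

lemma nc_coeff_induct_set:
  "(\<forall>f\<in>A. Q (Nc f)) \<Longrightarrow> nc_coeff x \<in> A \<Longrightarrow> Q x"
  using nc_coeff_inverse by metis

section \<open>The free algebra and the Weyl ideal inside the ring of series\<close>

definition free_ncs :: "nat \<Rightarrow> 'k::field ncs set" where
  "free_ncs d = {x. nc_coeff x \<in> free_alg d}"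

lemma free_ncs_const_mult: "x \<in> free_ncs d \<Longrightarrow> nc_const c * x \<in> free_ncs d"
  by (auto simp: free_ncs_def free_alg_def fa_smul_def elim: finite_subset[rotated])

lemma free_ncs_add: "x \<in> free_ncs d \<Longrightarrow> y \<in> free_ncs d \<Longrightarrow> x + y \<in> free_ncs d"
  unfolding free_ncs_def free_alg_def nc_coeff_simps fa_add_def mem_Collect_eq
  by (intro conjI allI impI ballI
      finite_subset[of "{w. nc_coeff x w + nc_coeff y w \<noteq> 0}" "{w. nc_coeff x w \<noteq> 0} \<union> {w. nc_coeff y w \<noteq> 0}"])
    (auto, metis add.right_neutral)

lemma free_ncs_word: "set w \<subseteq> {..<d} \<Longrightarrow> nc_word w \<in> free_ncs d"
  by (auto simp: free_ncs_def free_alg_def nc_word_def split: if_splits)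

lemma free_ncs_1: "1 \<in> free_ncs d"
  using free_ncs_word[of "[]"] by simp

lemma free_ncs_const: "nc_const c \<in> free_ncs d"
  using free_ncs_const_mult[OF free_ncs_1] by simp

lemma nc_const_0 [simp]: "nc_const 0 = 0"
  by (simp add: nc_inject nc_const_def nc_coeff_simps fa_smul_def fa_zero_def)

lemma nc_const_uminus: "nc_const (- c) = - nc_const c"
  using nc_const_add[of c "- c"] by (simp add: eq_neg_iff_add_eq_0 add.commute)

lemma free_ncs_uminus: "x \<in> free_ncs d \<Longrightarrow> - x \<in> free_ncs d"
  using free_ncs_const_mult[of x d "- 1"] by (simp add: nc_const_uminus)

lemma free_ncs_diff: "x \<in> free_ncs d \<Longrightarrow> y \<in> free_ncs d \<Longrightarrow> x - y \<in> free_ncs d"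
  using free_ncs_add[OF _ free_ncs_uminus, of x d y] by simp

lemma free_ncs_0: "0 \<in> free_ncs d"
  using free_ncs_const[of 0] by simp

lemma free_ncs_mult:
  assumes "x \<in> free_ncs d" "y \<in> free_ncs d" shows "x * y \<in> free_ncs d"
proof -
  let ?X = "{w. nc_coeff x w \<noteq> 0}" and ?Y = "{w. nc_coeff y w \<noteq> 0}"
  have fin: "finite ?X" "finite ?Y" and lt: "\<And>w l. w \<in> ?X \<union> ?Y \<Longrightarrow> l \<in> set w \<Longrightarrow> l < d"
    using assms by (auto simp: free_ncs_def free_alg_def)
  have sub: "w \<in> (\<lambda>(u,w). u @ w) ` (?X \<times> ?Y)" if "nc_coeff (x * y) w \<noteq> 0" for w
  proof -
    have "(\<Sum>i\<in>{0..length w}. nc_coeff x (take i w) * nc_coeff y (drop i w)) \<noteq> 0"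
      using that by (simp add: nc_coeff_mult fa_mul_def)
    then obtain i where "nc_coeff x (take i w) * nc_coeff y (drop i w) \<noteq> 0"
      by (meson sum.neutral)
    then have "(take i w, drop i w) \<in> ?X \<times> ?Y" by simp
    then show ?thesis by (metis (mono_tags, lifting) append_take_drop_id case_prod_conv image_eqI)
  qed
  show ?thesis unfolding free_ncs_def free_alg_def mem_Collect_eq
  proof (intro conjI allI impI ballI)
    show "finite {w. nc_coeff (x * y) w \<noteq> 0}"
      by (rule finite_subset[OF _ finite_imageI[OF finite_cartesian_product[OF fin]]]) (use sub in blast)
  next
    fix w l assume "nc_coeff (x * y) w \<noteq> 0" "l \<in> set w"
    with sub lt show "l < d" by fastforce
  qed
qed

text \<open>Removes one word of the finite support at a time, so that linear statements reduce to
  words.\<close>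

lemma free_ncs_induct [consumes 1, case_names zero add]:
  assumes "x \<in> free_ncs d" and "Q 0"
    and step: "\<And>c w x. set w \<subseteq> {..<d} \<Longrightarrow> x \<in> free_ncs d \<Longrightarrow> Q x \<Longrightarrow> Q (nc_const c * nc_word w + x)"
  shows "Q x"
proof -
  have "finite {w. nc_coeff x w \<noteq> 0}" using assms(1) by (simp add: free_ncs_def free_alg_def)
  then show ?thesis using assms(1)
  proof (induction "{w. nc_coeff x w \<noteq> 0}" arbitrary: x rule: finite_induct)
    case empty
    then have "x = 0" by (auto simp: nc_inject nc_coeff_simps fa_zero_def)
    then show ?case using assms(2) by simp
  next
    case (insert w F)
    define c where "c = nc_coeff x w"
    define y where "y = x - nc_const c * nc_word w"
    have w: "set w \<subseteq> {..<d}" using insert by (auto simp: free_ncs_def free_alg_def)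
    have "nc_coeff y u = (if u = w then 0 else nc_coeff x u)" for u
      by (simp add: y_def c_def nc_coeff_simps fa_diff_def fa_smul_def nc_word_def)
    then have "F = {w. nc_coeff y w \<noteq> 0}" using insert(2,4) by auto
    moreover have "y \<in> free_ncs d"
      unfolding y_def using insert w by (intro free_ncs_diff free_ncs_const_mult free_ncs_word)
    ultimately have "Q y" using insert by blast
    from step[OF w \<open>y \<in> free_ncs d\<close> this, of c] show ?case by (simp add: y_def)
  qed
qed

definition nc_gen :: "nat \<Rightarrow> 'k::field ncs" where "nc_gen i = nc_word [i]"

lemma nc_word_Cons: "nc_word (i # w) = nc_gen i * nc_word w"
  using nc_word_append[of "[i]" w] by (simp add: nc_gen_def)

definition nc_rel :: "(nat \<Rightarrow> nat \<Rightarrow> 'k::field) \<Rightarrow> nat \<Rightarrow> nat \<Rightarrow> 'k ncs" where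
  "nc_rel \<Omega> i j = nc_gen i * nc_gen j - nc_gen j * nc_gen i - nc_const (\<Omega> i j)"

lemma Nc_weyl_rel: "Nc (weyl_rel \<Omega> i j) = nc_rel \<Omega> i j"
  by (simp add: nc_inject nc_rel_def weyl_rel_def nc_coeff_simps nc_coeff_mult nc_gen_def nc_word_single nc_const_def)

definition weyl_ncs :: "nat \<Rightarrow> (nat \<Rightarrow> nat \<Rightarrow> 'k::field) \<Rightarrow> 'k ncs set" where
  "weyl_ncs d \<Omega> = {x. nc_coeff x \<in> weyl_ideal d \<Omega>}"

lemma weyl_ncs_0: "0 \<in> weyl_ncs d \<Omega>"
  by (simp add: weyl_ncs_def nc_coeff_simps weyl_ideal.zero)

lemma weyl_ncs_add: "x \<in> weyl_ncs d \<Omega> \<Longrightarrow> y \<in> weyl_ncs d \<Omega> \<Longrightarrow> x + y \<in> weyl_ncs d \<Omega>"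
  by (simp add: weyl_ncs_def nc_coeff_simps weyl_ideal.add)

lemma weyl_ncs_gen:
  "a \<in> free_ncs d \<Longrightarrow> b \<in> free_ncs d \<Longrightarrow> i < d \<Longrightarrow> j < d \<Longrightarrow> a * nc_rel \<Omega> i j * b \<in> weyl_ncs d \<Omega>"
  by (simp add: weyl_ncs_def free_ncs_def nc_coeff_mult Nc_weyl_rel[symmetric] weyl_ideal.gen)

lemma weyl_ncs_induct [consumes 1, case_names zero gen add]:
  assumes "x \<in> weyl_ncs d \<Omega>" and "Q 0"
    and gen: "\<And>a b i j. a \<in> free_ncs d \<Longrightarrow> b \<in> free_ncs d \<Longrightarrow> i < d \<Longrightarrow> j < d \<Longrightarrow> Q (a * nc_rel \<Omega> i j * b)"
    and add: "\<And>x y. x \<in> weyl_ncs d \<Omega> \<Longrightarrow> y \<in> weyl_ncs d \<Omega> \<Longrightarrow> Q x \<Longrightarrow> Q y \<Longrightarrow> Q (x + y)"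
  shows "Q x"
proof (rule nc_coeff_induct_set)
  show "nc_coeff x \<in> weyl_ideal d \<Omega>" using assms(1) by (simp add: weyl_ncs_def)
  show "\<forall>f\<in>weyl_ideal d \<Omega>. Q (Nc f)"
  proof
    fix f assume "f \<in> weyl_ideal d \<Omega>"
    then show "Q (Nc f)"
    proof induction
      case zero
      then show ?case using assms(2) by (simp add: zero_ncs_def)
    next
      case (gen a b i j)
      then show ?case using assms(3)[of "Nc a" "Nc b" i j]
        by (simp add: free_ncs_def times_ncs_def Nc_weyl_rel[symmetric])
    next
      case (add x y)
      then show ?case using assms(4)[of "Nc x" "Nc y"] by (simp add: weyl_ncs_def plus_ncs_def)
    qed
  qed
qed

lemma weyl_ncs_mult_left:
  assumes "x \<in> weyl_ncs d \<Omega>" "y \<in> free_ncs d" shows "y * x \<in> weyl_ncs d \<Omega>"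
  using assms(1)
proof (induction rule: weyl_ncs_induct)
  case (gen a b i j)
  then show ?case using weyl_ncs_gen[OF free_ncs_mult[OF assms(2) gen(1)] gen(2-4)]
    by (simp add: mult.assoc)
qed (simp_all add: weyl_ncs_0 distrib_left weyl_ncs_add)

lemma weyl_ncs_mult_right:
  assumes "x \<in> weyl_ncs d \<Omega>" "y \<in> free_ncs d" shows "x * y \<in> weyl_ncs d \<Omega>"
  using assms(1)
proof (induction rule: weyl_ncs_induct)
  case (gen a b i j)
  then show ?case using weyl_ncs_gen[OF gen(1) free_ncs_mult[OF gen(2) assms(2)] gen(3-4)]
    by (simp add: mult.assoc)
qed (simp_all add: weyl_ncs_0 distrib_right weyl_ncs_add)

lemma weyl_ncs_const_mult: "x \<in> weyl_ncs d \<Omega> \<Longrightarrow> nc_const c * x \<in> weyl_ncs d \<Omega>"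
  by (rule weyl_ncs_mult_left[OF _ free_ncs_const])

lemma weyl_ncs_uminus: "x \<in> weyl_ncs d \<Omega> \<Longrightarrow> - x \<in> weyl_ncs d \<Omega>"
  using weyl_ncs_const_mult[of x d \<Omega> "- 1"] by (simp add: nc_const_uminus)

lemma weyl_ncs_diff: "x \<in> weyl_ncs d \<Omega> \<Longrightarrow> y \<in> weyl_ncs d \<Omega> \<Longrightarrow> x - y \<in> weyl_ncs d \<Omega>"
  using weyl_ncs_add[OF _ weyl_ncs_uminus, of x d \<Omega> y] by simp

lemma free_ncs_gen: "i < d \<Longrightarrow> nc_gen i \<in> free_ncs d"
  by (simp add: nc_gen_def free_ncs_word)

lemma weyl_ncs_subset_free: "x \<in> weyl_ncs d \<Omega> \<Longrightarrow> x \<in> free_ncs d"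
  by (induction rule: weyl_ncs_induct)
    (auto simp: nc_rel_def intro!: free_ncs_0 free_ncs_add free_ncs_mult free_ncs_diff free_ncs_gen free_ncs_const)

section \<open>The lattice generated by the rescaled basis, as an instance of the filtration\<close>

locale weyl_lattice = dvr v \<pi> for v :: "'k::field_char_0 \<Rightarrow> int" and \<pi> :: 'k +
  fixes d n :: nat and \<Omega> :: "nat \<Rightarrow> nat \<Rightarrow> 'k"
begin

definition Lat :: "'k ncs set" where
  "Lat = {x. nc_coeff x \<in> lattice_gen v \<pi> d n}"

abbreviation R where "R \<equiv> val_ring v"

abbreviation Weyl where "Weyl \<equiv> weyl_ncs d \<Omega>"

text \<open>These are the generators \<open>X\<^sub>i\<close> of the overview.\<close>

definition lgen :: "nat \<Rightarrow> 'k ncs" where "lgen i = nc_const (\<pi> ^ n) * nc_gen i"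

lemma Lat_const: "r \<in> R \<Longrightarrow> nc_const r \<in> Lat"
  by (simp add: Lat_def nc_const_def lattice_gen.scal)

lemma Lat_gen: "i < d \<Longrightarrow> lgen i \<in> Lat"
  by (simp add: Lat_def lgen_def lattice_gen.gen nc_gen_def nc_word_single)

lemma Lat_add: "x \<in> Lat \<Longrightarrow> y \<in> Lat \<Longrightarrow> x + y \<in> Lat"
  by (simp add: Lat_def nc_coeff_simps lattice_gen.add)

lemma Lat_mult: "x \<in> Lat \<Longrightarrow> y \<in> Lat \<Longrightarrow> x * y \<in> Lat"
  by (simp add: Lat_def nc_coeff_mult lattice_gen.mul)

lemma Lat_induct [consumes 1, case_names const gen add mult]:
  assumes "x \<in> Lat" and "\<And>r. r \<in> R \<Longrightarrow> Q (nc_const r)" and "\<And>i. i < d \<Longrightarrow> Q (lgen i)"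
    and "\<And>x y. x \<in> Lat \<Longrightarrow> y \<in> Lat \<Longrightarrow> Q x \<Longrightarrow> Q y \<Longrightarrow> Q (x + y)"
    and "\<And>x y. x \<in> Lat \<Longrightarrow> y \<in> Lat \<Longrightarrow> Q x \<Longrightarrow> Q y \<Longrightarrow> Q (x * y)"
  shows "Q x"
proof (rule nc_coeff_induct_set)
  show "nc_coeff x \<in> lattice_gen v \<pi> d n" using assms(1) by (simp add: Lat_def)
  show "\<forall>f\<in>lattice_gen v \<pi> d n. Q (Nc f)"
  proof
    fix f assume "f \<in> lattice_gen v \<pi> d n"
    then show "Q (Nc f)"
    proof induction
      case (scal r)
      then show ?case using assms(2) by (simp add: nc_const_def)
    next
      case (gen i)
      have "Nc (fa_smul (\<pi> ^ n) (fa_gen i)) = lgen i"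
        by (simp add: nc_inject lgen_def nc_gen_def nc_word_single)
      then show ?case using gen assms(3) by simp
    next
      case (add x y)
      then show ?case using assms(4)[of "Nc x" "Nc y"] by (simp add: Lat_def plus_ncs_def)
    next
      case (mul x y)
      then show ?case using assms(5)[of "Nc x" "Nc y"] by (simp add: Lat_def times_ncs_def)
    qed
  qed
qed

lemma Lat_subset_free: "x \<in> Lat \<Longrightarrow> x \<in> free_ncs d"
  by (induction rule: Lat_induct)
    (auto simp: lgen_def intro!: free_ncs_const free_ncs_const_mult free_ncs_gen free_ncs_add free_ncs_mult)

lemma Lat_const_mult: "r \<in> R \<Longrightarrow> x \<in> Lat \<Longrightarrow> nc_const r * x \<in> Lat"
  by (simp add: Lat_mult Lat_const)

lemma Lat_diff: "x \<in> Lat \<Longrightarrow> y \<in> Lat \<Longrightarrow> x - y \<in> Lat"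
  using Lat_add[OF _ Lat_const_mult[OF R_m1], of x y] by (simp add: nc_const_uminus)

definition Pw :: "nat \<Rightarrow> 'k ncs set" where
  "Pw a = {x. nc_coeff x \<in> lat_pow v \<pi> d \<Omega> n a}"

lemma Pw_iff: "x \<in> Pw a \<longleftrightarrow> (\<exists>f\<in>Lat. \<exists>b\<in>Weyl. x = nc_const (\<pi> ^ a) * f + b)"
proof
  assume "x \<in> Pw a"
  then obtain f b where "f \<in> lattice_gen v \<pi> d n" "b \<in> weyl_ideal d \<Omega>"
    "nc_coeff x = fa_add (fa_smul (\<pi> ^ a) f) b" by (auto simp: Pw_def lat_pow_def)
  then have "Nc f \<in> Lat" "Nc b \<in> Weyl" "x = nc_const (\<pi> ^ a) * Nc f + Nc b"
    by (auto simp: Lat_def weyl_ncs_def nc_inject nc_coeff_simps)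
  then show "\<exists>f\<in>Lat. \<exists>b\<in>Weyl. x = nc_const (\<pi> ^ a) * f + b" by blast
next
  assume "\<exists>f\<in>Lat. \<exists>b\<in>Weyl. x = nc_const (\<pi> ^ a) * f + b"
  then show "x \<in> Pw a"
    unfolding Pw_def Lat_def weyl_ncs_def lat_pow_def by (clarsimp simp: nc_coeff_simps) blast
qed

lemma Pw_of_Lat: "x \<in> Lat \<Longrightarrow> x \<in> Pw 0"
  unfolding Pw_iff by (rule bexI[of _ x]) (auto intro!: bexI[of _ 0] weyl_ncs_0)

lemma Pw_of_Weyl: "x \<in> Weyl \<Longrightarrow> x \<in> Pw a"
  unfolding Pw_iff using Lat_const[OF R_0] by (intro bexI[of _ 0] bexI[of _ x]) auto

lemma Pw_subset_free: "x \<in> Pw a \<Longrightarrow> x \<in> free_ncs d"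
  unfolding Pw_iff
  by (blast intro: free_ncs_add free_ncs_const_mult Lat_subset_free weyl_ncs_subset_free)

lemma nc_const_mult_mult:
  "(nc_const a * f) * (nc_const b * g) = nc_const (a * b) * (f * g)"
  by (metis mult.assoc nc_const_commute nc_const_mult)

sublocale pi_filtration nc_const \<pi> Pw
proof
  show "nc_const (c * d) = nc_const c * nc_const d" for c d :: 'k by (rule nc_const_mult)
  show "x * nc_const c = nc_const c * x" for c :: 'k and x by (rule nc_const_commute)
  show "\<exists>k. nc_const (\<pi> ^ k * c) \<in> Pw 0" for c
    using R_bounded[of c] by (auto intro: Pw_of_Lat Lat_const)
  show "\<pi> \<noteq> 0" by (rule pi_nonzero)
  show "0 \<in> Pw a" for a by (rule Pw_of_Weyl[OF weyl_ncs_0])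
  show "1 \<in> Pw 0" using Pw_of_Lat[OF Lat_const[OF R_1]] by simp
next
  fix x y a assume "x \<in> Pw a" "y \<in> Pw a"
  then obtain f b g c where fg: "f \<in> Lat" "b \<in> Weyl" "g \<in> Lat" "c \<in> Weyl"
    and eq: "x = nc_const (\<pi> ^ a) * f + b" "y = nc_const (\<pi> ^ a) * g + c"
    unfolding Pw_iff by blast
  have "x - y = nc_const (\<pi> ^ a) * (f - g) + (b - c)" unfolding eq by (simp add: algebra_simps)
  then show "x - y \<in> Pw a" unfolding Pw_iff using fg by (blast intro: Lat_diff weyl_ncs_diff)
next
  fix x y a a' assume "x \<in> Pw a" "y \<in> Pw a'"
  then obtain f b g c where fg: "f \<in> Lat" "b \<in> Weyl" "g \<in> Lat" "c \<in> Weyl"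
    and eq: "x = nc_const (\<pi> ^ a) * f + b" "y = nc_const (\<pi> ^ a') * g + c"
    unfolding Pw_iff by blast
  have "x * y = nc_const (\<pi> ^ (a + a')) * (f * g) + (nc_const (\<pi> ^ a) * f * c + b * y)"
    unfolding eq power_add nc_const_mult_mult[symmetric] by (simp add: distrib_left distrib_right)
  moreover have "nc_const (\<pi> ^ a) * f * c \<in> Weyl"
    using fg by (intro weyl_ncs_mult_left free_ncs_const_mult Lat_subset_free)
  moreover have "b * y \<in> Weyl"
    using fg Pw_subset_free[OF \<open>y \<in> Pw a'\<close>] by (intro weyl_ncs_mult_right)
  ultimately show "x * y \<in> Pw (a + a')"
    unfolding Pw_iff using fg by (blast intro: Lat_mult weyl_ncs_add)
next
  fix m x a
  show "nc_const (\<pi> ^ m) * x \<in> Pw (a + m) \<longleftrightarrow> x \<in> Pw a"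
  proof
    assume "nc_const (\<pi> ^ m) * x \<in> Pw (a + m)"
    then obtain f b where fb: "f \<in> Lat" "b \<in> Weyl"
      and eq: "nc_const (\<pi> ^ m) * x = nc_const (\<pi> ^ (a + m)) * f + b" unfolding Pw_iff by blast
    \<comment> \<open>The Weyl ideal is a K-subspace, so dividing by \<open>\<pi> ^ m\<close> keeps
      \<open>b\<close> in it and only lowers the exponent in front of \<open>f\<close>.\<close>
    have "x = nc_const (inverse (\<pi> ^ m)) * (nc_const (\<pi> ^ m) * x)"
      using pi_nonzero by (simp add: mult.assoc[symmetric] nc_const_mult[symmetric])
    also have "\<dots> = nc_const (\<pi> ^ a) * f + nc_const (inverse (\<pi> ^ m)) * b"
      unfolding eq using pi_nonzero
      by (simp add: distrib_left mult.assoc[symmetric] nc_const_mult[symmetric] power_add)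
        (simp add: field_simps)
    finally show "x \<in> Pw a" unfolding Pw_iff using fb weyl_ncs_const_mult by blast
  next
    assume "x \<in> Pw a"
    then obtain f b where fb: "f \<in> Lat" "b \<in> Weyl"
      and eq: "x = nc_const (\<pi> ^ a) * f + b" unfolding Pw_iff by blast
    have "nc_const (\<pi> ^ m) * x = nc_const (\<pi> ^ (a + m)) * f + nc_const (\<pi> ^ m) * b"
      unfolding eq
      by (simp add: distrib_left mult.assoc[symmetric] nc_const_mult[symmetric] power_add mult.commute)
    then show "nc_const (\<pi> ^ m) * x \<in> Pw (a + m)" unfolding Pw_iff using fb weyl_ncs_const_mult by blast
  qed
next
  fix x a assume "x \<in> Pw (Suc a)"
  then obtain f b where fb: "f \<in> Lat" "b \<in> Weyl"
    and eq: "x = nc_const (\<pi> ^ Suc a) * f + b" unfolding Pw_iff by blast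
  have "x = nc_const (\<pi> ^ a) * (nc_const \<pi> * f) + b"
    unfolding eq by (simp add: mult.assoc[symmetric] nc_const_mult[symmetric] mult.commute)
  then show "x \<in> Pw a" unfolding Pw_iff using fb Lat_const_mult[OF R_pi] by blast
qed simp

end

section \<open>The affinoid Weyl algebra as bounded Cauchy sequences modulo null sequences\<close>

context weyl_lattice
begin

text \<open>Reads the pair (k, s) as the sequence of the elements pi^(-k) s(a) of a K-algebra, where
  the formal denominator has become an honest scalar.\<close>

definition rep_seq :: "'k aff_rep \<Rightarrow> nat \<Rightarrow> 'k ncs" where
  "rep_seq p = (\<lambda>a. nc_const (inverse (\<pi> ^ fst p)) * Nc (snd p a))"

abbreviation valid where "valid \<equiv> aff_valid v \<pi> d \<Omega> n"

abbreviation AW where "AW \<equiv> affinoid_weyl v \<pi> d \<Omega> n"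

lemma Nc_mem_Pw: "Nc f \<in> Pw a \<longleftrightarrow> f \<in> lat_pow v \<pi> d \<Omega> n a"
  by (simp add: Pw_def)

lemma Nc_ops: "Nc (fa_add f g) = Nc f + Nc g" "Nc (fa_diff f g) = Nc f - Nc g"
  "Nc (fa_mul f g) = Nc f * Nc g" "Nc (fa_smul c f) = nc_const c * Nc f"
  "Nc fa_one = 1" "Nc fa_zero = 0"
  by (simp_all add: nc_inject nc_coeff_simps nc_coeff_mult[of "Nc f" "Nc g"])

lemma pi_power_rep_seq: "nc_const (\<pi> ^ fst p) * rep_seq p a = Nc (snd p a)"
  using pi_nonzero by (simp add: rep_seq_def sc_inverse)

lemma valid_iff_bseq: "valid p \<longleftrightarrow> bseq (fst p) (rep_seq p)"
  by (simp add: aff_valid_def bseq_def right_diff_distrib pi_power_rep_seq Nc_mem_Pw[symmetric] Nc_ops)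

lemma rep_seq_in_Cseq: "valid p \<Longrightarrow> rep_seq p \<in> Cseq"
  by (auto simp: valid_iff_bseq Cseq_def)

text \<open>Cross-multiplying the denominators of \<open>p\<close> and \<open>q\<close> multiplies
  the difference of their sequences by the power of \<open>\<pi>\<close> with exponent
  \<open>fst p + fst q + m\<close>. As \<open>nseq\<close> is monotone in its exponent, letting
  \<open>m\<close> grow covers every exponent.\<close>

lemma aff_eq_iff: "aff_eq v \<pi> d \<Omega> n p q \<longleftrightarrow> rep_seq p - rep_seq q \<in> Zseq"
proof -
  have eq: "Nc (fa_diff (fa_smul (\<pi> ^ (fst q + m)) (snd p a)) (fa_smul (\<pi> ^ (fst p + m)) (snd q a)))
      = nc_const (\<pi> ^ (fst p + fst q + m)) * (rep_seq p - rep_seq q) a" for m a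
  proof -
    have "nc_const (\<pi> ^ (fst p + fst q + m)) * rep_seq p a
        = nc_const (\<pi> ^ (fst q + m)) * (nc_const (\<pi> ^ fst p) * rep_seq p a)"
      by (subst mult.assoc[symmetric], subst nc_const_mult[symmetric]) (simp add: power_add ac_simps)
    moreover have "nc_const (\<pi> ^ (fst p + fst q + m)) * rep_seq q a
        = nc_const (\<pi> ^ (fst p + m)) * (nc_const (\<pi> ^ fst q) * rep_seq q a)"
      by (subst mult.assoc[symmetric], subst nc_const_mult[symmetric]) (simp add: power_add ac_simps)
    ultimately show ?thesis by (simp add: Nc_ops right_diff_distrib pi_power_rep_seq)
  qed
  have "aff_eq v \<pi> d \<Omega> n p q \<longleftrightarrow> (\<exists>m. nseq (fst p + fst q + m) (rep_seq p - rep_seq q))"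
    unfolding aff_eq_def nseq_def eq[symmetric] by (simp add: Nc_mem_Pw)
  also have "\<dots> \<longleftrightarrow> rep_seq p - rep_seq q \<in> Zseq"
    unfolding Zseq_def using nseq_mono le_add2 by blast
  finally show ?thesis .
qed

lemma ex_rep: "u \<in> Cseq \<Longrightarrow> \<exists>p. valid p \<and> rep_seq p = u"
proof -
  assume "u \<in> Cseq"
  then obtain k where k: "bseq k u" by (auto simp: Cseq_def)
  let ?p = "(k, \<lambda>a. nc_coeff (nc_const (\<pi> ^ k) * u a))"
  have "rep_seq ?p = u"
    using pi_nonzero by (simp add: rep_seq_def nc_coeff_inverse sc_inverse del: nc_coeff_const_mult)
  with k show ?thesis by (intro exI[of _ ?p]) (simp add: valid_iff_bseq)
qed

lemma rep_seq_ops: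
  "rep_seq (aff_addp \<pi> p q) = rep_seq p + rep_seq q"
  "rep_seq (aff_mulp p q) = rep_seq p * rep_seq q"
proof -
  have c: "nc_const (inverse (\<pi> ^ (k + l))) * (nc_const (\<pi> ^ l) * x) = nc_const (inverse (\<pi> ^ k)) * x" for k l x
  proof -
    have "inverse (\<pi> ^ (k + l)) * \<pi> ^ l = inverse (\<pi> ^ k)"
      using pi_nonzero by (simp add: power_add field_simps)
    then show ?thesis by (metis mult.assoc nc_const_mult)
  qed
  show "rep_seq (aff_addp \<pi> p q) = rep_seq p + rep_seq q"
    using c[of "fst p" "fst q"] c[of "fst q" "fst p"]
    by (simp add: fun_eq_iff rep_seq_def aff_addp_def Nc_ops distrib_left add.commute)
  show "rep_seq (aff_mulp p q) = rep_seq p * rep_seq q"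
    by (simp add: fun_eq_iff rep_seq_def aff_mulp_def Nc_ops nc_const_mult_mult power_add)
qed

text \<open>The coset of \<open>u\<close> modulo \<open>Zseq\<close>, in the encoding of
  \<open>affinoid_weyl\<close> as a set of pairs. With it the ring becomes \<open>Cseq\<close>
  modulo \<open>Zseq\<close> with pointwise operations.\<close>

definition elt :: "(nat \<Rightarrow> 'k ncs) \<Rightarrow> 'k aff_rep set" where
  "elt u = {q. valid q \<and> rep_seq q - u \<in> Zseq}"

lemma aff_cls_eq: "aff_cls v \<pi> d \<Omega> n p = elt (rep_seq p)"
  by (simp add: aff_cls_def elt_def aff_eq_iff)

lemma carrier_AW: "carrier AW = elt ` Cseq"
proof -
  have "Cseq = rep_seq ` {p. valid p}" using ex_rep rep_seq_in_Cseq by blast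
  then show ?thesis by (simp add: affinoid_weyl_def aff_cls_eq image_image)
qed

lemma zero_AW: "\<zero>\<^bsub>AW\<^esub> = elt 0" and one_AW: "\<one>\<^bsub>AW\<^esub> = elt 1"
  by (simp_all add: affinoid_weyl_def aff_cls_eq rep_seq_def Nc_ops zero_fun_def one_fun_def)

lemma elt_cong_imp: "u - w \<in> Zseq \<Longrightarrow> elt u \<subseteq> elt w"
  using Zseq_add[of _ "u - w"] by (fastforce simp: elt_def)

lemma elt_eq_iff: "u \<in> Cseq \<Longrightarrow> elt u = elt w \<longleftrightarrow> u - w \<in> Zseq"
proof
  assume u: "u \<in> Cseq" and eq: "elt u = elt w"
  obtain p where "valid p" "rep_seq p = u" using ex_rep[OF u] by blast
  then have "p \<in> elt u" using Zseq_0 by (simp add: elt_def)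
  then have "p \<in> elt w" using eq by simp
  then show "u - w \<in> Zseq" using \<open>rep_seq p = u\<close> by (simp add: elt_def)
next
  assume "u - w \<in> Zseq"
  then show "elt u = elt w" using Zseq_uminus[of "u - w"] elt_cong_imp[of u w] elt_cong_imp[of w u] by auto
qed

lemma add_AW:
  assumes "u \<in> Cseq" "w \<in> Cseq" shows "elt u \<oplus>\<^bsub>AW\<^esub> elt w = elt (u + w)"
proof -
  have "elt u \<oplus>\<^bsub>AW\<^esub> elt w
    = {q. valid q \<and> (\<exists>x\<in>elt u. \<exists>y\<in>elt w. rep_seq q - (rep_seq x + rep_seq y) \<in> Zseq)}"
    by (simp add: affinoid_weyl_def aff_eq_iff rep_seq_ops)
  also have "\<dots> = elt (u + w)"
  proof safe
    fix q x y assume q: "valid q" and x: "x \<in> elt u" and y: "y \<in> elt w"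
      and z: "rep_seq q - (rep_seq x + rep_seq y) \<in> Zseq"
    have "rep_seq q - (u + w) = rep_seq q - (rep_seq x + rep_seq y) + ((rep_seq x - u) + (rep_seq y - w))"
      by simp
    also have "\<dots> \<in> Zseq" using x y z by (intro Zseq_add) (auto simp: elt_def)
    finally show "q \<in> elt (u + w)" using q by (simp add: elt_def)
  next
    fix q assume q: "q \<in> elt (u + w)"
    then show "valid q" by (simp add: elt_def)
    obtain x y where "valid x" "rep_seq x = u" "valid y" "rep_seq y = w"
      using ex_rep assms by blast
    then show "\<exists>x\<in>elt u. \<exists>y\<in>elt w. rep_seq q - (rep_seq x + rep_seq y) \<in> Zseq"
      using q Zseq_0 by (intro bexI[of _ x] bexI[of _ y]) (auto simp: elt_def)
  qed
  finally show ?thesis .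
qed

lemma mult_AW:
  assumes "u \<in> Cseq" "w \<in> Cseq" shows "elt u \<otimes>\<^bsub>AW\<^esub> elt w = elt (u * w)"
proof -
  have "elt u \<otimes>\<^bsub>AW\<^esub> elt w
    = {q. valid q \<and> (\<exists>x\<in>elt u. \<exists>y\<in>elt w. rep_seq q - (rep_seq x * rep_seq y) \<in> Zseq)}"
    by (simp add: affinoid_weyl_def aff_eq_iff rep_seq_ops)
  also have "\<dots> = elt (u * w)"
  proof safe
    fix q x y assume q: "valid q" and x: "x \<in> elt u" and y: "y \<in> elt w"
      and z: "rep_seq q - (rep_seq x * rep_seq y) \<in> Zseq"
    have "rep_seq q - u * w = rep_seq q - (rep_seq x * rep_seq y)
        + ((rep_seq x - u) * rep_seq y + u * (rep_seq y - w))"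
      by (simp add: algebra_simps)
    also have "\<dots> \<in> Zseq"
      using x y z assms by (intro Zseq_add Zseq_mult) (auto simp: elt_def rep_seq_in_Cseq)
    finally show "q \<in> elt (u * w)" using q by (simp add: elt_def)
  next
    fix q assume q: "q \<in> elt (u * w)"
    then show "valid q" by (simp add: elt_def)
    obtain x y where "valid x" "rep_seq x = u" "valid y" "rep_seq y = w"
      using ex_rep assms by blast
    then show "\<exists>x\<in>elt u. \<exists>y\<in>elt w. rep_seq q - (rep_seq x * rep_seq y) \<in> Zseq"
      using q Zseq_0 by (intro bexI[of _ x] bexI[of _ y]) (auto simp: elt_def)
  qed
  finally show ?thesis .
qed

lemma ring_AW: "ring AW"
proof (intro ringI abelian_groupI monoidI)
  show "\<exists>y\<in>carrier AW. y \<oplus>\<^bsub>AW\<^esub> x = \<zero>\<^bsub>AW\<^esub>" if "x \<in> carrier AW" for x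
  proof -
    obtain u where u: "u \<in> Cseq" "x = elt u" using \<open>x \<in> carrier AW\<close> by (auto simp: carrier_AW)
    then have "elt (- u) \<oplus>\<^bsub>AW\<^esub> x = \<zero>\<^bsub>AW\<^esub>" by (simp add: add_AW Cseq_uminus zero_AW)
    then show ?thesis using u Cseq_uminus by (auto simp: carrier_AW)
  qed
qed (auto simp: carrier_AW zero_AW one_AW add_AW mult_AW Cseq_0 Cseq_1 Cseq_add Cseq_mult algebra_simps)

text \<open>Ideals of the quotient pull back to two-sided ideals of \<open>Cseq\<close> containing
  \<open>Zseq\<close>, so simplicity becomes a statement about bounded sequences: such an ideal
  contains 1 as soon as it has an element that is not null.\<close>

lemma simple_ring_AW:
  assumes one: "1 \<notin> Zseq"
    and crit: "\<And>J u. \<lbrakk>J \<subseteq> Cseq; Zseq \<subseteq> J; \<And>x y. x \<in> J \<Longrightarrow> y \<in> J \<Longrightarrow> x + y \<in> J;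
        \<And>x y. x \<in> Cseq \<Longrightarrow> y \<in> J \<Longrightarrow> x * y \<in> J; \<And>x y. x \<in> Cseq \<Longrightarrow> y \<in> J \<Longrightarrow> y * x \<in> J;
        u \<in> J; u \<notin> Zseq\<rbrakk> \<Longrightarrow> 1 \<in> J"
  shows "simple_ring AW"
  unfolding simple_ring_def
proof (intro conjI allI impI ring_AW)
  show "\<zero>\<^bsub>AW\<^esub> \<noteq> \<one>\<^bsub>AW\<^esub>"
    using elt_eq_iff[OF Cseq_1, of 0] one by (auto simp: zero_AW one_AW)
next
  fix J assume J: "ideal J AW"
  have sub: "additive_subgroup J AW" using J by (rule ideal.axioms)
  note J_subset = additive_subgroup.a_subset[OF sub]
    and J_zero = additive_subgroup.zero_closed[OF sub]
    and J_add = additive_subgroup.a_closed[OF sub]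
    and J_left = ideal.I_l_closed[OF J] and J_right = ideal.I_r_closed[OF J]
  define J' where "J' = {u \<in> Cseq. elt u \<in> J}"
  show "J = {\<zero>\<^bsub>AW\<^esub>} \<or> J = carrier AW"
  proof (cases "J = {\<zero>\<^bsub>AW\<^esub>}")
    case False
    then obtain X where X: "X \<in> J" "X \<noteq> \<zero>\<^bsub>AW\<^esub>" using J_zero by blast
    then obtain u where u: "u \<in> Cseq" "X = elt u" using J_subset by (auto simp: carrier_AW)
    have "1 \<in> J'"
    proof (rule crit)
      show "u \<in> J'" using u X by (simp add: J'_def)
      show "u \<notin> Zseq" using u X elt_eq_iff[of u 0] by (simp add: zero_AW)
      show "Zseq \<subseteq> J'"
      proof
        fix z assume z: "z \<in> Zseq"
        then have "elt z = \<zero>\<^bsub>AW\<^esub>" using elt_eq_iff[OF Zseq_subset_Cseq[OF z], of 0] by (simp add: zero_AW)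
        then show "z \<in> J'" using z Zseq_subset_Cseq J_zero by (simp add: J'_def)
      qed
      show "J' \<subseteq> Cseq" by (auto simp: J'_def)
      show "x + y \<in> J'" if "x \<in> J'" "y \<in> J'" for x y
        using that J_add[of "elt x" "elt y"] by (simp add: J'_def Cseq_add add_AW)
      show "x * y \<in> J'" if "x \<in> Cseq" "y \<in> J'" for x y
        using that J_left[of "elt y" "elt x"] by (simp add: J'_def Cseq_mult mult_AW carrier_AW)
      show "y * x \<in> J'" if "x \<in> Cseq" "y \<in> J'" for x y
        using that J_right[of "elt y" "elt x"] by (simp add: J'_def Cseq_mult mult_AW carrier_AW)
    qed
    then have "\<one>\<^bsub>AW\<^esub> \<in> J" by (simp add: J'_def one_AW)
    then show ?thesis using ideal.one_imp_carrier[OF J] by blast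
  qed simp
qed

end

section \<open>Nontriviality: the polynomial representation\<close>

text \<open>A polynomial is represented by its coefficients, a function of the exponent vector; no finiteness
  of the support is needed.\<close>

definition mult_op :: "nat \<Rightarrow> ((nat \<Rightarrow> nat) \<Rightarrow> 'k::field) \<Rightarrow> (nat \<Rightarrow> nat) \<Rightarrow> 'k" where
  "mult_op i g = (\<lambda>\<beta>. if \<beta> i = 0 then 0 else g (\<beta>(i := \<beta> i - 1)))"

definition deriv_op :: "nat \<Rightarrow> ((nat \<Rightarrow> nat) \<Rightarrow> 'k::field) \<Rightarrow> (nat \<Rightarrow> nat) \<Rightarrow> 'k" where
  "deriv_op i g = (\<lambda>\<beta>. of_nat (Suc (\<beta> i)) * g (\<beta>(i := Suc (\<beta> i))))"

text \<open>Summing over \<open>j < i\<close> only lets each pair of indices enter one of its two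
  operators, so that its commutator receives the entry of \<open>\<Omega>\<close> in full. The
  symmetric choice, half of \<open>\<Omega>\<close> in both operators, would lose integrality when 2
  is not a unit.\<close>

definition weyl_op :: "(nat \<Rightarrow> nat \<Rightarrow> 'k::field) \<Rightarrow> nat \<Rightarrow> ((nat \<Rightarrow> nat) \<Rightarrow> 'k) \<Rightarrow> (nat \<Rightarrow> nat) \<Rightarrow> 'k" where
  "weyl_op \<Omega> i g = (\<lambda>\<beta>. mult_op i g \<beta> + (\<Sum>j<i. \<Omega> i j * deriv_op j g \<beta>))"

lemma mult_op_commute: "mult_op i (mult_op k g) = mult_op k (mult_op i g)"
  by (cases "i = k") (auto simp: mult_op_def fun_upd_twist)

lemma deriv_op_commute: "deriv_op i (deriv_op k g) = deriv_op k (deriv_op i g)"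
  by (cases "i = k") (auto simp: deriv_op_def fun_upd_twist mult.left_commute)

lemma deriv_mult_op: "deriv_op i (mult_op k g) \<beta> = mult_op k (deriv_op i g) \<beta> + (if i = k then g \<beta> else 0)"
  by (auto simp: deriv_op_def mult_op_def fun_upd_twist fun_upd_idem algebra_simps)

lemma mult_op_linear:
  "mult_op i (\<lambda>\<beta>. f \<beta> + (\<Sum>j\<in>J. c j * h j \<beta>)) \<beta> = mult_op i f \<beta> + (\<Sum>j\<in>J. c j * mult_op i (h j) \<beta>)"
  by (simp add: mult_op_def)

lemma deriv_op_linear:
  "deriv_op i (\<lambda>\<beta>. f \<beta> + (\<Sum>j\<in>J. c j * h j \<beta>)) \<beta> = deriv_op i f \<beta> + (\<Sum>j\<in>J. c j * deriv_op i (h j) \<beta>)"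
  by (simp add: deriv_op_def distrib_left sum_distrib_left mult.left_commute)

lemma weyl_op_add: "weyl_op \<Omega> i (\<lambda>\<beta>. f \<beta> + g \<beta>) \<beta> = weyl_op \<Omega> i f \<beta> + weyl_op \<Omega> i g \<beta>"
  by (simp add: weyl_op_def mult_op_def deriv_op_def distrib_left sum.distrib)

lemma weyl_op_scale: "weyl_op \<Omega> i (\<lambda>\<beta>. c * f \<beta>) \<beta> = c * weyl_op \<Omega> i f \<beta>"
  by (simp add: weyl_op_def mult_op_def deriv_op_def distrib_left sum_distrib_left mult.left_commute)

text \<open>Multiplications are moved to the left of derivatives. Every summand except the last is
  then symmetric in \<open>i\<close> and \<open>k\<close>, the double sum because derivatives
  commute, so the commutator is visible in the last summand.\<close>

lemma weyl_op_weyl_op: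
  "weyl_op \<Omega> i (weyl_op \<Omega> k g) \<beta> = mult_op i (mult_op k g) \<beta>
     + ((\<Sum>l<k. \<Omega> k l * mult_op i (deriv_op l g) \<beta>) + (\<Sum>j<i. \<Omega> i j * mult_op k (deriv_op j g) \<beta>))
     + (\<Sum>j<i. \<Sum>l<k. \<Omega> i j * \<Omega> k l * deriv_op j (deriv_op l g) \<beta>)
     + (if k < i then \<Omega> i k * g \<beta> else 0)"
proof -
  have "(\<Sum>j<i. \<Omega> i j * (if j = k then g \<beta> else 0)) = (if k < i then \<Omega> i k * g \<beta> else 0)"
    by (simp add: if_distrib[where f="\<lambda>x. _ * x"] sum.delta cong: if_cong)
  then show ?thesis
    by (subst weyl_op_def)
      (simp add: weyl_op_def[of \<Omega> k] mult_op_linear deriv_op_linear deriv_mult_op distrib_left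
        sum.distrib sum_distrib_left mult.assoc add.assoc add.commute add.left_commute)
qed

lemma weyl_op_commutator:
  assumes alt: "\<Omega> i i = 0" "\<Omega> k i = - \<Omega> i k"
  shows "weyl_op \<Omega> i (weyl_op \<Omega> k g) \<beta> - weyl_op \<Omega> k (weyl_op \<Omega> i g) \<beta> = \<Omega> i k * g \<beta>"
proof -
  have "(\<Sum>j<i. \<Sum>l<k. \<Omega> i j * \<Omega> k l * deriv_op j (deriv_op l g) \<beta>)
      = (\<Sum>l<k. \<Sum>j<i. \<Omega> k l * \<Omega> i j * deriv_op l (deriv_op j g) \<beta>)"
    by (subst sum.swap) (simp add: deriv_op_commute mult.commute mult.left_commute)
  then show ?thesis
    using alt by (cases i k rule: linorder_cases)
      (simp_all add: weyl_op_weyl_op mult_op_commute[of k i])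
qed

section \<open>The action of the free algebra through these operators\<close>

definition word_op :: "(nat \<Rightarrow> nat \<Rightarrow> 'k::field) \<Rightarrow> nat list \<Rightarrow> ((nat \<Rightarrow> nat) \<Rightarrow> 'k) \<Rightarrow> (nat \<Rightarrow> nat) \<Rightarrow> 'k" where
  "word_op \<Omega> w = foldr (weyl_op \<Omega>) w"

text \<open>A sum over an infinite support is 0 by convention, so additivity and multiplicativity of
  the action are stated on \<open>free_ncs\<close>.\<close>

definition act :: "(nat \<Rightarrow> nat \<Rightarrow> 'k::field) \<Rightarrow> 'k ncs \<Rightarrow> ((nat \<Rightarrow> nat) \<Rightarrow> 'k) \<Rightarrow> (nat \<Rightarrow> nat) \<Rightarrow> 'k" where
  "act \<Omega> x g = (\<lambda>\<beta>. \<Sum>w | nc_coeff x w \<noteq> 0. nc_coeff x w * word_op \<Omega> w g \<beta>)"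

lemma word_op_add: "word_op \<Omega> w (\<lambda>\<beta>. f \<beta> + g \<beta>) = (\<lambda>\<beta>. word_op \<Omega> w f \<beta> + word_op \<Omega> w g \<beta>)"
  by (induction w) (simp_all add: word_op_def weyl_op_add)

lemma word_op_scale: "word_op \<Omega> w (\<lambda>\<beta>. c * f \<beta>) = (\<lambda>\<beta>. c * word_op \<Omega> w f \<beta>)"
  by (induction w) (simp_all add: word_op_def weyl_op_scale)

lemma free_ncs_finite: "x \<in> free_ncs d \<Longrightarrow> finite {w. nc_coeff x w \<noteq> 0}"
  by (simp add: free_ncs_def free_alg_def)

lemma act_superset:
  "finite S \<Longrightarrow> {w. nc_coeff x w \<noteq> 0} \<subseteq> S \<Longrightarrow> act \<Omega> x g \<beta> = (\<Sum>w\<in>S. nc_coeff x w * word_op \<Omega> w g \<beta>)"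
  unfolding act_def by (rule sum.mono_neutral_left) auto

lemma act_add:
  assumes "x \<in> free_ncs d" "y \<in> free_ncs d"
  shows "act \<Omega> (x + y) g = (\<lambda>\<beta>. act \<Omega> x g \<beta> + act \<Omega> y g \<beta>)"
proof
  fix \<beta>
  define S where "S = {w. nc_coeff x w \<noteq> 0} \<union> {w. nc_coeff y w \<noteq> 0}"
  have S: "finite S" using assms by (simp add: S_def free_ncs_finite)
  have "{w. nc_coeff (x + y) w \<noteq> 0} \<subseteq> S" "{w. nc_coeff x w \<noteq> 0} \<subseteq> S" "{w. nc_coeff y w \<noteq> 0} \<subseteq> S"
    by (auto simp: S_def nc_coeff_simps fa_add_def)
  then show "act \<Omega> (x + y) g \<beta> = act \<Omega> x g \<beta> + act \<Omega> y g \<beta>"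
    by (simp add: act_superset[OF S] nc_coeff_simps fa_add_def distrib_right sum.distrib)
qed

lemma act_const_mult: "act \<Omega> (nc_const c * x) g = (\<lambda>\<beta>. c * act \<Omega> x g \<beta>)"
  by (cases "c = 0") (auto simp: act_def fa_smul_def fun_eq_iff nc_coeff_simps fa_zero_def sum_distrib_left mult.assoc)

lemma act_word: "act \<Omega> (nc_word w) g = word_op \<Omega> w g"
proof
  fix \<beta>
  have "act \<Omega> (nc_word w) g \<beta> = (\<Sum>u\<in>{w}. nc_coeff (nc_word w) u * word_op \<Omega> u g \<beta>)"
    by (rule act_superset) (auto simp: nc_word_def)
  then show "act \<Omega> (nc_word w) g \<beta> = word_op \<Omega> w g \<beta>" by (simp add: nc_word_def)
qed

lemma act_0: "act \<Omega> 0 g = (\<lambda>\<beta>. 0)"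
  by (simp add: act_def nc_coeff_simps fa_zero_def)

lemma act_1: "act \<Omega> 1 g = g"
  using act_word[of \<Omega> "[]" g] by (simp add: word_op_def)

lemma act_word_mult:
  assumes w: "set w \<subseteq> {..<d}" and "y \<in> free_ncs d"
  shows "act \<Omega> (nc_word w * y) g = word_op \<Omega> w (act \<Omega> y g)"
  using assms(2)
proof (induction rule: free_ncs_induct)
  case zero
  show ?case using word_op_scale[of \<Omega> w 0] by (simp add: act_0)
next
  case (add c u y)
  have "nc_word w * (nc_const c * nc_word u + y) = nc_const c * nc_word (w @ u) + nc_word w * y"
    by (simp add: distrib_left nc_word_append) (metis mult.assoc nc_const_commute)
  moreover have "nc_const c * nc_word (w @ u) \<in> free_ncs d" "nc_word w * y \<in> free_ncs d"
    using w add by (auto intro!: free_ncs_const_mult free_ncs_word free_ncs_mult)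
  moreover have "nc_const c * nc_word u \<in> free_ncs d"
    using add by (auto intro!: free_ncs_const_mult free_ncs_word)
  ultimately show ?case
    using add by (simp add: act_add act_const_mult act_word word_op_add word_op_scale)
      (simp add: word_op_def)
qed

lemma act_mult:
  assumes "x \<in> free_ncs d" and y: "y \<in> free_ncs d"
  shows "act \<Omega> (x * y) g = act \<Omega> x (act \<Omega> y g)"
  using assms(1)
proof (induction rule: free_ncs_induct)
  case (add c u x)
  have "(nc_const c * nc_word u + x) * y = nc_const c * (nc_word u * y) + x * y"
    by (simp add: distrib_right mult.assoc)
  moreover have "nc_const c * (nc_word u * y) \<in> free_ncs d" "x * y \<in> free_ncs d"
    "nc_const c * nc_word u \<in> free_ncs d"
    using y add by (auto intro!: free_ncs_const_mult free_ncs_word free_ncs_mult)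
  ultimately show ?case
    using add y by (simp add: act_add act_const_mult act_word act_word_mult)
qed (simp add: act_0)

lemma act_gen: "act \<Omega> (nc_gen i) g = weyl_op \<Omega> i g"
  by (simp add: nc_gen_def act_word word_op_def)

locale alternating_weyl_lattice = weyl_lattice v \<pi> d n \<Omega>
  for v :: "'k::field_char_0 \<Rightarrow> int" and \<pi> and d n :: nat and \<Omega> +
  assumes Om_R: "i < d \<Longrightarrow> j < d \<Longrightarrow> \<Omega> i j \<in> val_ring v"
    and Om_diag: "i < d \<Longrightarrow> \<Omega> i i = 0"
    and Om_skew: "i < d \<Longrightarrow> j < d \<Longrightarrow> \<Omega> j i = - \<Omega> i j"
begin

lemma act_rel:
  assumes "i < d" "j < d" shows "act \<Omega> (nc_rel \<Omega> i j) g = (\<lambda>\<beta>. 0)"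
proof
  fix \<beta>
  have eq: "nc_rel \<Omega> i j = nc_gen i * nc_gen j + (nc_const (- 1) * (nc_gen j * nc_gen i) + nc_const (- \<Omega> i j) * 1)"
    by (simp add: nc_rel_def nc_const_uminus)
  have h: "nc_gen i * nc_gen j \<in> free_ncs d" "nc_const (- 1) * (nc_gen j * nc_gen i) \<in> free_ncs d"
    "nc_const (- \<Omega> i j) * 1 \<in> free_ncs d"
    using assms by (auto intro!: free_ncs_const_mult free_ncs_gen free_ncs_mult free_ncs_const)
  have "act \<Omega> (nc_rel \<Omega> i j) g \<beta>
      = act \<Omega> (nc_gen i * nc_gen j) g \<beta> + (act \<Omega> (nc_const (- 1) * (nc_gen j * nc_gen i)) g \<beta>
        + act \<Omega> (nc_const (- \<Omega> i j) * 1) g \<beta>)"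
    unfolding eq by (simp only: act_add[OF h(1) free_ncs_add[OF h(2,3)]] act_add[OF h(2,3)])
  also have "\<dots> = weyl_op \<Omega> i (weyl_op \<Omega> j g) \<beta> - weyl_op \<Omega> j (weyl_op \<Omega> i g) \<beta> - \<Omega> i j * g \<beta>"
    using assms by (simp only: act_const_mult act_mult[where d = d] free_ncs_gen act_gen act_1) simp
  also have "\<dots> = 0" using weyl_op_commutator[of \<Omega> i j g \<beta>, OF Om_diag[OF assms(1)] Om_skew[OF assms]] by simp
  finally show "act \<Omega> (nc_rel \<Omega> i j) g \<beta> = 0" .
qed

lemma nc_rel_free: "i < d \<Longrightarrow> j < d \<Longrightarrow> nc_rel \<Omega> i j \<in> free_ncs d"
  by (auto simp: nc_rel_def intro!: free_ncs_mult free_ncs_diff free_ncs_gen free_ncs_const)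

lemma act_zero_fun: "act \<Omega> x (\<lambda>\<beta>. 0) = (\<lambda>\<beta>. 0)"
  using word_op_scale[of \<Omega> _ 0 "\<lambda>\<beta>. 0"] by (simp add: act_def)

lemma act_weyl: "x \<in> Weyl \<Longrightarrow> act \<Omega> x g = (\<lambda>\<beta>. 0)"
proof (induction rule: weyl_ncs_induct)
  case (gen a b i j)
  then show ?case
    by (simp add: act_mult[of _ d] free_ncs_mult nc_rel_free act_rel act_zero_fun)
next
  case (add x y)
  then show ?case using act_add[of x d y] by (simp add: weyl_ncs_subset_free)
qed (simp add: act_0)

text \<open>Multiplication by a variable moves coefficients, a derivative also multiplies them by
  natural numbers, and the entries of \<open>\<Omega>\<close> are integral.\<close>

lemma weyl_op_integral:
  "i < d \<Longrightarrow> (\<And>\<beta>. g \<beta> \<in> R) \<Longrightarrow> weyl_op \<Omega> i g \<beta> \<in> R"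
  unfolding weyl_op_def mult_op_def deriv_op_def
  by (intro R_add R_sum R_mult Om_R) (auto intro: R_0 R_of_nat simp del: of_nat_Suc)

lemma act_Lat_integral: "x \<in> Lat \<Longrightarrow> (\<And>\<beta>. g \<beta> \<in> R) \<Longrightarrow> act \<Omega> x g \<beta> \<in> R"
proof (induction arbitrary: g \<beta> rule: Lat_induct)
  case (const r)
  then show ?case using act_const_mult[of \<Omega> r 1 g] by (simp add: act_1 R_mult)
next
  case (gen i)
  then show ?case by (simp add: lgen_def act_const_mult act_gen R_mult R_power R_pi weyl_op_integral)
next
  case (add x y)
  then show ?case by (simp add: act_add[OF Lat_subset_free Lat_subset_free] R_add)
next
  case (mult x y)
  then show ?case by (simp add: act_mult[OF Lat_subset_free Lat_subset_free])
qed

lemma one_notin_Pw1: "1 \<notin> Pw 1"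
proof
  assume "1 \<in> Pw 1"
  then obtain f b where fb: "f \<in> Lat" "b \<in> Weyl" "1 = nc_const \<pi> * f + b"
    unfolding Pw_iff by auto
  \<comment> \<open>A test function: it is integral and takes the value 1 at exponent 0, where the
    equation is evaluated.\<close>
  define g :: "(nat \<Rightarrow> nat) \<Rightarrow> 'k" where "g = (\<lambda>\<beta>. 1)"
  have "act \<Omega> 1 g = (\<lambda>\<beta>. act \<Omega> (nc_const \<pi> * f) g \<beta> + act \<Omega> b g \<beta>)"
    unfolding fb(3) using fb
    by (intro act_add[where d = d]) (auto intro: free_ncs_const_mult Lat_subset_free weyl_ncs_subset_free)
  then have "1 = \<pi> * act \<Omega> f g (\<lambda>_. 0)"
    using fb by (simp add: act_1 act_const_mult act_weyl g_def fun_eq_iff)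
  then have "inverse \<pi> = act \<Omega> f g (\<lambda>_. 0)"
    using pi_nonzero by (simp add: field_simps)
  moreover have "act \<Omega> f g (\<lambda>_. 0) \<in> R"
    using fb by (intro act_Lat_integral) (auto simp: g_def R_1)
  ultimately show False using inverse_pi_notin_R by simp
qed

lemma one_notin_Zseq: "1 \<notin> Zseq"
proof
  assume "1 \<in> Zseq"
  then obtain k where "nseq k 1" by (auto simp: Zseq_def)
  \<comment> \<open>The index is taken one beyond the denominator, so that cancelling
    \<open>\<pi> ^ k\<close> leaves 1 in \<open>Pw 1\<close>.\<close>
  then have "nc_const (\<pi> ^ k) * 1 \<in> Pw (1 + k)" by (simp add: nseq_def)
  then show False using one_notin_Pw1 unfolding P_shift by simp
qed

end

section \<open>Dual vectors\<close>

lemma sum_fun_apply: "(sum f A) x = (\<Sum>a\<in>A. f a x)" for f :: "'a \<Rightarrow> 'b \<Rightarrow> 'c::comm_monoid_add"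
  by (induction A rule: infinite_finite_induct) simp_all

lemma vector_space_fun: "vector_space (\<lambda>(c::'k::field) (f :: nat \<Rightarrow> 'k) x. c * f x)"
  by (rule vector_space.intro) (simp_all add: fun_eq_iff algebra_simps)

text \<open>The rows of \<open>\<Omega>\<close> are independent because its left kernel is zero.
  Being \<open>d\<close> independent vectors in the span of \<open>d\<close> unit vectors, they span
  it, and the coefficients that express the unit vector \<open>e i\<close> are the ones
  sought.\<close>

lemma dual_vector_exists:
  fixes \<Omega> :: "nat \<Rightarrow> nat \<Rightarrow> 'k::field"
  assumes ker: "\<And>x i. (\<And>j. j < d \<Longrightarrow> (\<Sum>k<d. x k * \<Omega> k j) = 0) \<Longrightarrow> i < d \<Longrightarrow> x i = 0"
    and i: "i < d"
  obtains c where "\<And>j. j < d \<Longrightarrow> (\<Sum>k<d. c k * \<Omega> k j) = (if j = i then 1 else 0)"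
proof -
  interpret vector_space "\<lambda>(c::'k) (f :: nat \<Rightarrow> 'k) x. c * f x" by (rule vector_space_fun)
  \<comment> \<open>The rows are cut off at \<open>d\<close> to lie in the span of the first
    \<open>d\<close> unit vectors.\<close>
  define r where "r k = (\<lambda>j. if j < d then \<Omega> k j else 0)" for k
  define e where "e k = (\<lambda>j::nat. if j = k then 1 else (0::'k))" for k
  let ?S = "r ` {..<d}" and ?T = "e ` {..<d}"
  \<comment> \<open>The rows enter as a set; only when they are distinct does a combination over
    that set turn into one over the indices. Two equal rows would give the nonzero kernel vector
    \<open>e k - e l\<close>.\<close>
  have inj: "inj_on r {..<d}"
  proof (rule inj_onI, rule ccontr)
    fix k l assume kl: "k \<in> {..<d}" "l \<in> {..<d}" "r k = r l" "k \<noteq> l"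
    have "(\<Sum>m<d. (e k m - e l m) * \<Omega> m j) = 0" if "j < d" for j
      using kl(1,2) fun_cong[OF kl(3), of j] that
      by (simp add: e_def left_diff_distrib sum_subtractf r_def
          if_distrib[where f="\<lambda>x. x * _"] cong: if_cong)
    from ker[OF this, of k] show False using kl by (simp add: e_def)
  qed
  have indep: "independent ?S"
  proof (rule independent_if_scalars_zero)
    fix f x assume f: "(\<Sum>x\<in>?S. (\<lambda>j. f x * x j)) = 0" and "x \<in> ?S"
    then obtain k where k: "k < d" "x = r k" by auto
    have "(\<Sum>k<d. f (r k) * \<Omega> k j) = 0" if "j < d" for j
    proof -
      have "(\<Sum>k<d. f (r k) * r k j) = 0"
        using fun_cong[OF f, of j] by (simp add: sum.reindex[OF inj] sum_fun_apply)
      then show ?thesis using that by (simp add: r_def)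
    qed
    from ker[OF this k(1)] show "f x = 0" using k by simp
  qed simp
  have "span ?T \<supseteq> insert (e i) ?S"
  proof
    fix x assume "x \<in> insert (e i) ?S"
    moreover have "r k \<in> span ?T" for k
    proof -
      have "r k = (\<Sum>j<d. (\<lambda>l. r k j * e j l))"
        by (auto simp: fun_eq_iff sum_fun_apply e_def r_def if_distrib[where f="\<lambda>x. _ * x"] cong: if_cong)
      also have "\<dots> \<in> span ?T" by (intro span_sum span_scale span_base) auto
      finally show ?thesis .
    qed
    ultimately show "x \<in> span ?T" using i by (auto intro: span_base)
  qed
  then have bound: "independent (insert (e i) ?S) \<Longrightarrow> card (insert (e i) ?S) \<le> card ?T"
    using independent_span_bound[of ?T] by auto
  have "e i \<in> span ?S"
  proof (rule ccontr)
    assume e: "e i \<notin> span ?S"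
    then have "e i \<notin> ?S" using span_base[of "e i" ?S] by blast
    then have "card (insert (e i) ?S) = Suc d" by (simp add: card_image[OF inj])
    moreover have "card ?T \<le> d" using card_image_le[of "{..<d}" e] by simp
    ultimately show False using bound independent_insertI[OF e indep] by simp
  qed
  then obtain u where "e i = (\<Sum>x\<in>?S. (\<lambda>j. u x * x j))" by (auto simp: span_finite)
  then have u: "e i j = (\<Sum>k<d. u (r k) * r k j)" for j
    by (simp add: sum.reindex[OF inj] sum_fun_apply)
  show thesis
  proof (rule that[of "\<lambda>k. u (r k)"])
    fix j assume "j < d"
    then show "(\<Sum>k<d. u (r k) * \<Omega> k j) = (if j = i then 1 else 0)"
      using u[of j] by (simp add: r_def e_def)
  qed
qed

section \<open>Spanning by ordered monomials\<close>

context alternating_weyl_lattice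
begin

definition lword :: "nat list \<Rightarrow> 'k ncs" where
  "lword w = nc_const (\<pi> ^ (n * length w)) * nc_word w"

lemma lword_Nil [simp]: "lword [] = 1"
  by (simp add: lword_def)

lemma lword_Cons: "lword (i # w) = lgen i * lword w"
  unfolding lword_def lgen_def nc_const_mult_mult by (simp add: nc_word_Cons power_add)

lemma lword_in_Lat: "set w \<subseteq> {..<d} \<Longrightarrow> lword w \<in> Lat"
  using Lat_const[OF R_1] by (induction w) (auto simp: lword_Cons intro: Lat_mult Lat_gen)

lemma lgen_commutator:
  assumes "j < d" "k < d"
  shows "lgen j * lgen k - lgen k * lgen j - nc_const (\<pi> ^ (n + n) * \<Omega> j k) \<in> Weyl"
proof -
  have "lgen j * lgen k - lgen k * lgen j - nc_const (\<pi> ^ (n + n) * \<Omega> j k)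
      = nc_const (\<pi> ^ (n + n)) * nc_rel \<Omega> j k"
    unfolding lgen_def nc_const_mult_mult nc_rel_def
    by (simp add: right_diff_distrib nc_const_mult power_add)
  then show ?thesis
    using weyl_ncs_const_mult[OF weyl_ncs_gen[OF free_ncs_1 free_ncs_1 assms]] by simp
qed

definition sorted_words :: "nat list set" where
  "sorted_words = {w. sorted w \<and> set w \<subseteq> {..<d}}"

text \<open>The R-span of the ordered words, modulo the Weyl ideal. The length bound is strict, so
  \<open>sspan (length w)\<close> holds the terms of lower degree than \<open>w\<close>, and
  \<open>sspan 0\<close> is the Weyl ideal.\<close>

inductive_set sspan :: "nat \<Rightarrow> 'k ncs set" for m where
  weyl: "b \<in> Weyl \<Longrightarrow> b \<in> sspan m"
| step: "r \<in> R \<Longrightarrow> w \<in> sorted_words \<Longrightarrow> length w < m \<Longrightarrow> x \<in> sspan m \<Longrightarrow> nc_const r * lword w + x \<in> sspan m"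

lemma sspan_add: "x \<in> sspan m \<Longrightarrow> y \<in> sspan m \<Longrightarrow> x + y \<in> sspan m"
proof (induction rule: sspan.induct)
  case (weyl b)
  from weyl(2,1) show ?case
  proof (induction rule: sspan.induct)
    case (weyl b')
    then show ?case by (blast intro: sspan.weyl weyl_ncs_add)
  next
    case (step r w x)
    then show ?case using sspan.step[of r w m "b + x"] by (simp add: add.left_commute)
  qed
next
  case (step r w x)
  then show ?case using sspan.step[of r w m "x + y"] by (simp add: add.assoc)
qed

lemma sspan_mono: "x \<in> sspan m \<Longrightarrow> m \<le> l \<Longrightarrow> x \<in> sspan l"
  by (induction rule: sspan.induct) (auto intro: sspan.intros)

lemma sspan_scale: "x \<in> sspan m \<Longrightarrow> r \<in> R \<Longrightarrow> nc_const r * x \<in> sspan m"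
proof (induction rule: sspan.induct)
  case (weyl b)
  then show ?case by (blast intro: sspan.weyl weyl_ncs_const_mult)
next
  case (step r' w x)
  then have "nc_const (r * r') * lword w + nc_const r * x \<in> sspan m"
    by (auto intro: sspan.step R_mult)
  then show ?case by (simp add: distrib_left nc_const_mult mult.assoc)
qed

lemma sspan_lword: "w \<in> sorted_words \<Longrightarrow> length w < m \<Longrightarrow> lword w \<in> sspan m"
  using sspan.step[OF R_1 _ _ sspan.weyl[OF weyl_ncs_0], of w m] by simp

lemma sorted_words_insort: "w \<in> sorted_words \<Longrightarrow> j < d \<Longrightarrow> insort j w \<in> sorted_words"
  by (auto simp: sorted_words_def sorted_insort set_insort_key)

text \<open>Kept apart with the reordering rule as a hypothesis on words shorter than
  \<open>m\<close>, since the induction that proves this rule has to multiply such spans before the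
  rule is known in general.\<close>

lemma lgen_sspan_aux:
  assumes claim: "\<And>w. w \<in> sorted_words \<Longrightarrow> length w < m
      \<Longrightarrow> lgen j * lword w - lword (insort j w) \<in> sspan (length w)"
    and j: "j < d" and x: "x \<in> sspan m"
  shows "lgen j * x \<in> sspan (Suc m)"
  using x
proof (induction rule: sspan.induct)
  case (weyl b)
  then show ?case using j by (blast intro: sspan.weyl weyl_ncs_mult_left Lat_subset_free Lat_gen)
next
  case (step r w x)
  have "lgen j * lword w - lword (insort j w) \<in> sspan (Suc m)"
    using claim[of w] step sspan_mono[of _ "length w" "Suc m"] by auto
  moreover have "lword (insort j w) \<in> sspan (Suc m)"
    using step j by (intro sspan_lword) (auto simp: sorted_words_insort)
  ultimately have "lgen j * lword w \<in> sspan (Suc m)" using sspan_add by fastforce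
  then have "nc_const r * (lgen j * lword w) + lgen j * x \<in> sspan (Suc m)"
    using step by (intro sspan_add sspan_scale)
  moreover have "lgen j * (nc_const r * lword w) = nc_const r * (lgen j * lword w)"
    by (metis mult.assoc nc_const_commute)
  ultimately show ?case by (simp add: distrib_left)
qed

text \<open>When \<open>j\<close> exceeds the first letter \<open>k\<close> of \<open>w\<close>,
  exchanging the two generators costs an integral scalar times the tail, and \<open>j\<close> is
  then inserted into the tail by induction. A commutator removes two letters at once, so the error
  stays below the length of \<open>w\<close>.\<close>

lemma lgen_lword_insort:
  "w \<in> sorted_words \<Longrightarrow> j < d \<Longrightarrow> lgen j * lword w - lword (insort j w) \<in> sspan (length w)"
proof (induction "length w" arbitrary: w j rule: less_induct)
  case less
  have zero: "0 \<in> sspan m" for m by (rule sspan.weyl[OF weyl_ncs_0])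
  show ?case
  proof (cases w)
    case Nil
    then show ?thesis using zero by (simp add: lword_Cons)
  next
    case (Cons k u)
    then have u: "u \<in> sorted_words" and k: "k < d" and len: "length w = Suc (length u)"
      using less(2) by (auto simp: sorted_words_def)
    show ?thesis
    proof (cases "j \<le> k")
      case True
      then show ?thesis using Cons zero by (simp add: lword_Cons)
    next
      case False
      define \<kappa> where "\<kappa> = \<pi> ^ (n + n) * \<Omega> j k"
      have "lgen j * lword u - lword (insort j u) \<in> sspan (length u)"
        using less(1)[of u j] u less(3) len by simp
      then have "lgen k * (lgen j * lword u - lword (insort j u)) \<in> sspan (length w)"
        \<comment> \<open>Multiplying the error by \<open>lgen k\<close> may destroy the order
          again, but its words are shorter than \<open>u\<close>, so the induction hypothesis, now
          for the letter \<open>k\<close>, reorders them.\<close>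
        unfolding len using lgen_sspan_aux[of "length u" k] less(1) k len by simp
      moreover have "(lgen j * lgen k - lgen k * lgen j - nc_const \<kappa>) * lword u \<in> sspan (length w)"
        unfolding \<kappa>_def using u
        by (intro sspan.weyl weyl_ncs_mult_right lgen_commutator less(3) k Lat_subset_free lword_in_Lat)
          (auto simp: sorted_words_def)
      moreover have "nc_const \<kappa> * lword u \<in> sspan (length w)"
        unfolding \<kappa>_def using u len k less(3)
        by (intro sspan_scale sspan_lword R_mult R_power R_pi Om_R) auto
      ultimately have "lgen k * (lgen j * lword u - lword (insort j u))
          + (lgen j * lgen k - lgen k * lgen j - nc_const \<kappa>) * lword u
          + nc_const \<kappa> * lword u \<in> sspan (length w)"
        by (intro sspan_add)
      moreover have "lgen j * lword w - lword (insort j w)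
        = lgen k * (lgen j * lword u - lword (insort j u))
          + (lgen j * lgen k - lgen k * lgen j - nc_const \<kappa>) * lword u
          + nc_const \<kappa> * lword u"
        using Cons False by (simp add: lword_Cons algebra_simps)
      ultimately show ?thesis by simp
    qed
  qed
qed

lemma lgen_sspan: "j < d \<Longrightarrow> x \<in> sspan m \<Longrightarrow> lgen j * x \<in> sspan (Suc m)"
  by (rule lgen_sspan_aux) (auto intro: lgen_lword_insort)

lemma lword_sspan: "set w \<subseteq> {..<d} \<Longrightarrow> x \<in> sspan m \<Longrightarrow> \<exists>l. lword w * x \<in> sspan l"
proof (induction w)
  case (Cons j w)
  then obtain l where "lword w * x \<in> sspan l" by auto
  then have "lword (j # w) * x \<in> sspan (Suc l)"
    using lgen_sspan[of j "lword w * x" l] Cons by (simp add: lword_Cons mult.assoc)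
  then show ?case ..
qed auto

lemma sspan_mult:
  assumes "x \<in> sspan m" "y \<in> sspan l" "y \<in> free_ncs d" shows "\<exists>k. x * y \<in> sspan k"
  using assms(1)
proof (induction rule: sspan.induct)
  case (weyl b)
  then show ?case using assms(3) by (blast intro: sspan.weyl weyl_ncs_mult_right)
next
  case (step r w x)
  obtain k where k: "x * y \<in> sspan k" using step by blast
  obtain k' where k': "lword w * y \<in> sspan k'"
    using lword_sspan[OF _ assms(2), of w] step by (auto simp: sorted_words_def)
  have "nc_const r * (lword w * y) + x * y \<in> sspan (max k k')"
    using k k' step by (intro sspan_add sspan_scale) (auto intro: sspan_mono)
  then show ?case by (auto simp: distrib_right mult.assoc)
qed

lemma Lat_sspan: "x \<in> Lat \<Longrightarrow> \<exists>m. x \<in> sspan m"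
proof (induction rule: Lat_induct)
  case (const r)
  then have "nc_const r * lword [] + 0 \<in> sspan 1"
    by (intro sspan.step sspan.weyl weyl_ncs_0) (auto simp: sorted_words_def)
  then show ?case by auto
next
  case (gen i)
  then have "lword [i] \<in> sspan 2" by (intro sspan_lword) (auto simp: sorted_words_def)
  then show ?case by (auto simp: lword_Cons)
next
  case (add x y)
  then obtain m l where "x \<in> sspan m" "y \<in> sspan l" by blast
  then have "x + y \<in> sspan (max m l)" by (intro sspan_add) (auto intro: sspan_mono)
  then show ?case ..
next
  case (mult x y)
  then show ?case using sspan_mult Lat_subset_free by blast
qed

section \<open>Finite combinations of ordered words and their reduction modulo \<pi>\<close>

definition lcomb :: "nat list set \<Rightarrow> (nat list \<Rightarrow> 'k) \<Rightarrow> 'k ncs" where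
  "lcomb B c = (\<Sum>w\<in>B. nc_const (c w) * lword w)"

lemma sspan_lcomb:
  "x \<in> sspan m \<Longrightarrow> \<exists>B c. finite B \<and> B \<subseteq> sorted_words \<and> (\<forall>w. c w \<in> R) \<and> x - lcomb B c \<in> Weyl"
proof (induction rule: sspan.induct)
  case (weyl b)
  then show ?case by (intro exI[of _ "{}"] exI[of _ "\<lambda>_. 0"]) (auto simp: lcomb_def R_0)
next
  case (step r w x)
  then obtain B c where B: "finite B" "B \<subseteq> sorted_words" "\<forall>w. c w \<in> R" "x - lcomb B c \<in> Weyl"
    by blast
  \<comment> \<open>The word \<open>w\<close> may already occur in \<open>B\<close>; then
    \<open>r\<close> is added to its coefficient.\<close>
  define c' where "c' u = (if u \<in> B then c u else 0) + (if u = w then r else 0)" for u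
  have "lcomb (insert w B) c' = (\<Sum>u\<in>insert w B. nc_const (if u \<in> B then c u else 0) * lword u)
      + (\<Sum>u\<in>insert w B. nc_const (if u = w then r else 0) * lword u)"
    by (simp add: lcomb_def c'_def nc_const_add distrib_right sum.distrib)
  also have "(\<Sum>u\<in>insert w B. nc_const (if u \<in> B then c u else 0) * lword u) = lcomb B c"
    unfolding lcomb_def using B(1) by (intro sum.mono_neutral_cong_right) auto
  also have "(\<Sum>u\<in>insert w B. nc_const (if u = w then r else 0) * lword u) = (\<Sum>u\<in>{w}. nc_const r * lword u)"
    using B(1) by (intro sum.mono_neutral_cong_right) auto
  finally have "nc_const r * lword w + x - lcomb (insert w B) c' = x - lcomb B c" by simp
  then have "nc_const r * lword w + x - lcomb (insert w B) c' \<in> Weyl" using B(4) by (simp only:)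
  moreover have "c' u \<in> R" for u using B step by (auto simp: c'_def R_0 intro: R_add)
  ultimately show ?case
    using B(1,2) step(2) by (intro exI[of _ "insert w B"] exI[of _ c'] conjI) auto
qed

lemma Pw_sum: "(\<And>i. i \<in> I \<Longrightarrow> F i \<in> Pw a) \<Longrightarrow> sum F I \<in> Pw a"
  by (induction I rule: infinite_finite_induct) (auto simp: P_zero intro: P_add)

lemma unit_lcomb:
  assumes f: "f \<in> Pw 0" "f \<notin> Pw 1"
  obtains B c where "finite B" "B \<noteq> {}" "B \<subseteq> sorted_words"
    "\<forall>w\<in>B. c w \<noteq> 0 \<and> v (c w) = 0" "f - lcomb B c \<in> Pw 1"
proof -
  obtain g b where gb: "g \<in> Lat" "b \<in> Weyl" "f = g + b" using f(1) unfolding Pw_iff by auto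
  obtain m where "g \<in> sspan m" using Lat_sspan[OF gb(1)] ..
  from sspan_lcomb[OF this] obtain B c
    where B: "finite B" "B \<subseteq> sorted_words" "\<forall>w. c w \<in> R" "g - lcomb B c \<in> Weyl"
    by (elim exE conjE)
  define U where "U = {w \<in> B. c w \<noteq> 0 \<and> v (c w) = 0}"
  have "lcomb B c = lcomb (B - U) c + lcomb U c"
    unfolding lcomb_def using B(1) by (intro sum.subset_diff) (auto simp: U_def)
  then have "f - lcomb U c = b + (g - lcomb B c) + lcomb (B - U) c"
    using gb(3) by simp
  moreover have "b + (g - lcomb B c) \<in> Pw 1" using gb B by (intro Pw_of_Weyl weyl_ncs_add)
  moreover have "lcomb (B - U) c \<in> Pw 1" unfolding lcomb_def
  proof (rule Pw_sum)
    fix w assume w: "w \<in> B - U"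
    have "nc_const (inverse \<pi> * c w) * lword w \<in> Pw 0"
      using w B by (intro Pw_of_Lat Lat_const_mult R_nonunit lword_in_Lat) (auto simp: U_def sorted_words_def)
    then have "nc_const (\<pi> ^ 1) * (nc_const (inverse \<pi> * c w) * lword w) \<in> Pw (0 + 1)"
      by (simp only: P_shift)
    then show "nc_const (c w) * lword w \<in> Pw 1"
      using pi_nonzero by (simp add: mult.assoc[symmetric] nc_const_mult[symmetric])
  qed
  ultimately have *: "f - lcomb U c \<in> Pw 1" by (simp add: P_add)
  show thesis
  proof (rule that[OF _ _ _ _ *])
    show "U \<noteq> {}" using * f(2) by (auto simp: lcomb_def)
  qed (use B in \<open>auto simp: U_def\<close>)
qed

end

section \<open>Divided powers of inner derivations\<close>

text \<open>This is (ad y)^m / m!, the factorial being divided out one factor at a time.\<close>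

primrec ddiv :: "'k::field_char_0 ncs \<Rightarrow> nat \<Rightarrow> 'k ncs \<Rightarrow> 'k ncs" where
  "ddiv y 0 x = x"
| "ddiv y (Suc m) x = nc_const (inverse (of_nat (Suc m))) * (y * ddiv y m x - ddiv y m x * y)"

declare ddiv.simps(2) [simp del]

lemma ddiv_add: "ddiv y m (x + z) = ddiv y m x + ddiv y m z"
  by (induction m) (simp_all add: ddiv.simps(2) algebra_simps)

lemma ddiv_const_mult: "ddiv y m (nc_const c * x) = nc_const c * ddiv y m x"
proof (induction m)
  case (Suc m)
  have "y * (nc_const c * z) - nc_const c * z * y = nc_const c * (y * z - z * y)" for z
    by (simp add: right_diff_distrib) (metis mult.assoc nc_const_commute)
  then show ?case
    by (simp only: ddiv.simps Suc) (metis mult.assoc nc_const_commute)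
qed simp

lemma ddiv_diff: "ddiv y m (x - z) = ddiv y m x - ddiv y m z"
  using ddiv_add[of y m "x - z" z] by simp

lemma ddiv_0: "ddiv y m 0 = 0"
  using ddiv_diff[of y m 0 0] by simp

lemma ddiv_sum: "ddiv y m (sum f I) = (\<Sum>i\<in>I. ddiv y m (f i))"
  by (induction I rule: infinite_finite_induct) (simp_all add: ddiv_0 ddiv_add)

lemma ddiv_1: "ddiv y (Suc m) 1 = 0"
  by (induction m) (simp_all add: ddiv.simps(2))

lemma ddiv_weyl: "y \<in> free_ncs d \<Longrightarrow> x \<in> weyl_ncs d \<Omega> \<Longrightarrow> ddiv y m x \<in> weyl_ncs d \<Omega>"
  by (induction m)
    (simp_all add: ddiv.simps(2) weyl_ncs_const_mult weyl_ncs_diff weyl_ncs_mult_left weyl_ncs_mult_right)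

lemma ddiv_free: "y \<in> free_ncs d \<Longrightarrow> x \<in> free_ncs d \<Longrightarrow> ddiv y m x \<in> free_ncs d"
  by (induction m) (auto simp: ddiv.simps(2) intro!: free_ncs_const_mult free_ncs_diff free_ncs_mult)

context alternating_weyl_lattice
begin

text \<open>Modulo the Weyl relations, \<open>ad y\<close> is then the partial derivative in the i-th variable.\<close>

definition dual_to :: "nat \<Rightarrow> 'k ncs \<Rightarrow> bool" where
  "dual_to i y \<longleftrightarrow> y \<in> free_ncs d \<and>
     (\<forall>j<d. y * lgen j - lgen j * y - (if j = i then 1 else 0) \<in> Weyl)"

lemma Weyl_trans: "x - y \<in> Weyl \<Longrightarrow> y - z \<in> Weyl \<Longrightarrow> x - z \<in> Weyl"
  using weyl_ncs_add[of "x - y" d \<Omega> "y - z"] by simp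

lemma free_ncs_sum: "(\<And>k. k \<in> I \<Longrightarrow> f k \<in> free_ncs d) \<Longrightarrow> sum f I \<in> free_ncs d"
  by (induction I rule: infinite_finite_induct) (auto intro: free_ncs_0 free_ncs_add)

lemma weyl_ncs_sum: "(\<And>k. k \<in> I \<Longrightarrow> f k \<in> Weyl) \<Longrightarrow> sum f I \<in> Weyl"
  by (induction I rule: infinite_finite_induct) (auto intro: weyl_ncs_0 weyl_ncs_add)

lemma nc_const_sum: "nc_const (sum f I) = (\<Sum>k\<in>I. nc_const (f k))" for f :: "nat \<Rightarrow> 'k"
  by (induction I rule: infinite_finite_induct) (simp_all add: nc_const_add)

text \<open>The vector that is dual to the i-th basis vector under the form, divided by
  \<open>\<pi> ^ n\<close> to balance the factor \<open>\<pi> ^ n\<close> in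
  \<open>lgen\<close>.\<close>

lemma dual_toI:
  assumes c: "\<And>j. j < d \<Longrightarrow> (\<Sum>k<d. c k * \<Omega> k j) = (if j = i then 1 else 0)"
  shows "dual_to i (\<Sum>k<d. nc_const (inverse (\<pi> ^ n) * c k) * nc_gen k)"
  unfolding dual_to_def
proof (intro conjI allI impI)
  let ?y = "\<Sum>k<d. nc_const (inverse (\<pi> ^ n) * c k) * nc_gen k"
  show "?y \<in> free_ncs d" by (intro free_ncs_sum free_ncs_const_mult free_ncs_gen) auto
  fix j assume j: "j < d"
  have scal: "nc_const (inverse (\<pi> ^ n) * c k) * nc_gen k * lgen j = nc_const (c k) * (nc_gen k * nc_gen j)"
    "lgen j * (nc_const (inverse (\<pi> ^ n) * c k) * nc_gen k) = nc_const (c k) * (nc_gen j * nc_gen k)" for k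
  proof -
    have eq: "inverse (\<pi> ^ n) * c k * \<pi> ^ n = c k" "\<pi> ^ n * (inverse (\<pi> ^ n) * c k) = c k"
      using pi_nonzero by simp_all
    show "nc_const (inverse (\<pi> ^ n) * c k) * nc_gen k * lgen j = nc_const (c k) * (nc_gen k * nc_gen j)"
      "lgen j * (nc_const (inverse (\<pi> ^ n) * c k) * nc_gen k) = nc_const (c k) * (nc_gen j * nc_gen k)"
      unfolding lgen_def nc_const_mult_mult eq by (rule refl)+
  qed
  have "(if j = i then 1 else 0) = (\<Sum>k<d. nc_const (c k) * nc_const (\<Omega> k j))"
    using arg_cong[OF c[OF j], of nc_const] by (simp add: nc_const_sum nc_const_mult split: if_splits)
  then have "?y * lgen j - lgen j * ?y - (if j = i then 1 else 0) = (\<Sum>k<d. nc_const (c k) * nc_rel \<Omega> k j)"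
    by (simp add: sum_distrib_left sum_distrib_right scal sum_subtractf nc_rel_def right_diff_distrib)
  also have "\<dots> \<in> Weyl"
    using weyl_ncs_gen[OF free_ncs_1 free_ncs_1, of _ d j \<Omega>] j
    by (intro weyl_ncs_sum weyl_ncs_const_mult) auto
  finally show "?y * lgen j - lgen j * ?y - (if j = i then 1 else 0) \<in> Weyl" .
qed

text \<open>\<open>ad y\<close> is a derivation that sends \<open>lgen j\<close> to the scalar 0 or
  1 modulo the Weyl ideal, so two terms of the Leibniz expansion of order \<open>Suc m\<close>
  survive. The binomial factor \<open>Suc m\<close> of the second is absorbed by the
  factorials.\<close>

lemma ddiv_lgen_mult:
  assumes y: "dual_to i y" and j: "j < d" and g: "g \<in> free_ncs d"
  shows "ddiv y (Suc m) (lgen j * g)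
      - (lgen j * ddiv y (Suc m) g + (if j = i then ddiv y m g else 0)) \<in> Weyl"
proof -
  define D where "D x = y * x - x * y" for x
  define \<delta> :: "'k ncs" where "\<delta> = (if j = i then 1 else 0)"
  have yf: "y \<in> free_ncs d" and yj: "D (lgen j) - \<delta> \<in> Weyl"
    using y j by (auto simp: dual_to_def D_def \<delta>_def)
  have E: "ddiv y (Suc m) x = nc_const (inverse (of_nat (Suc m))) * D (ddiv y m x)" for m x
    by (simp add: D_def ddiv.simps(2))
  have D_lgen: "D (lgen j * x) - (lgen j * D x + \<delta> * x) \<in> Weyl" if "x \<in> free_ncs d" for x
  proof -
    have "D (lgen j * x) - (lgen j * D x + \<delta> * x) = (D (lgen j) - \<delta>) * x"
      by (simp add: D_def algebra_simps)
    then show ?thesis using weyl_ncs_mult_right[OF yj that] by simp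
  qed
  have D_delta: "D (\<delta> * x) = \<delta> * D x" for x by (simp add: \<delta>_def D_def)
  have D_weyl: "D x \<in> Weyl" if "x \<in> Weyl" for x
    using that yf unfolding D_def by (intro weyl_ncs_diff weyl_ncs_mult_left weyl_ncs_mult_right)
  have "ddiv y (Suc m) (lgen j * g) - (lgen j * ddiv y (Suc m) g + \<delta> * ddiv y m g) \<in> Weyl"
  proof (induction m)
    case 0
    then show ?case using D_lgen[OF g] by (simp add: E)
  next
    case (Suc m)
    let ?a = "ddiv y (Suc m) g" and ?q = "nc_const (inverse (of_nat (Suc (Suc m)))) :: 'k ncs"
    \<comment> \<open>One copy of \<open>\<delta> * ?a\<close> comes from differentiating
      \<open>lgen j\<close> now and \<open>Suc m\<close> copies from the earlier steps; together
      they cancel the new denominator \<open>Suc (Suc m)\<close>.\<close>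
    have "D (ddiv y m g) = nc_const (of_nat (Suc m)) * ?a"
      unfolding E by (simp only: sc_inverse of_nat_neq_0 not_False_eq_True)
    moreover have "nc_const (of_nat (Suc (Suc m))) * ?a = ?a + nc_const (of_nat (Suc m)) * ?a"
      by (simp only: of_nat_Suc[of "Suc m"] nc_const_add nc_const_1 distrib_right mult_1_left)
    ultimately have "lgen j * D ?a + \<delta> * ?a + \<delta> * D (ddiv y m g)
        = lgen j * D ?a + \<delta> * (nc_const (of_nat (Suc (Suc m))) * ?a)"
      by (simp only: distrib_left add.assoc)
    moreover have "?q * (lgen j * D ?a) = lgen j * (?q * D ?a)"
      by (metis mult.assoc nc_const_commute)
    moreover have "?q * (\<delta> * (nc_const (of_nat (Suc (Suc m))) * ?a)) = \<delta> * ?a"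
    proof -
      have "?q * (\<delta> * (nc_const (of_nat (Suc (Suc m))) * ?a)) = \<delta> * (?q * (nc_const (of_nat (Suc (Suc m))) * ?a))"
        by (metis mult.assoc nc_const_commute)
      then show ?thesis by (simp only: sc_inverse of_nat_neq_0 not_False_eq_True)
    qed
    ultimately have rhs: "?q * (lgen j * D ?a + \<delta> * ?a + \<delta> * D (ddiv y m g))
        = lgen j * ddiv y (Suc (Suc m)) g + \<delta> * ?a"
      unfolding E[of "Suc m"] by (simp only: distrib_left)
    have "D (ddiv y (Suc m) (lgen j * g) - (lgen j * ?a + \<delta> * ddiv y m g)) \<in> Weyl"
      by (rule D_weyl[OF Suc])
    moreover have "D (lgen j * ?a) - (lgen j * D ?a + \<delta> * ?a) \<in> Weyl"
      by (rule D_lgen[OF ddiv_free[OF yf g]])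
    ultimately have "D (ddiv y (Suc m) (lgen j * g) - (lgen j * ?a + \<delta> * ddiv y m g))
        + (D (lgen j * ?a) - (lgen j * D ?a + \<delta> * ?a)) \<in> Weyl"
      by (rule weyl_ncs_add)
    moreover have "D (ddiv y (Suc m) (lgen j * g) - (lgen j * ?a + \<delta> * ddiv y m g))
        + (D (lgen j * ?a) - (lgen j * D ?a + \<delta> * ?a))
        = D (ddiv y (Suc m) (lgen j * g)) - (lgen j * D ?a + \<delta> * ?a + \<delta> * D (ddiv y m g))"
      unfolding D_delta[symmetric] by (simp add: D_def algebra_simps)
    ultimately have "?q * (D (ddiv y (Suc m) (lgen j * g))
        - (lgen j * D ?a + \<delta> * ?a + \<delta> * D (ddiv y m g))) \<in> Weyl"
      by (simp only: weyl_ncs_const_mult)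
    then show ?case
      unfolding right_diff_distrib rhs E[of "Suc m" "lgen j * g"] .
  qed
  then show ?thesis by (simp add: \<delta>_def if_distrib[where f="\<lambda>x. x * _"] cong: if_cong)
qed

lemma lword_free: "set w \<subseteq> {..<d} \<Longrightarrow> lword w \<in> free_ncs d"
  by (rule Lat_subset_free[OF lword_in_Lat])

lemma Weyl_mult_lgen: "j < d \<Longrightarrow> x \<in> Weyl \<Longrightarrow> lgen j * x \<in> Weyl"
  by (blast intro: weyl_ncs_mult_left Lat_subset_free Lat_gen)

lemma Weyl_cong: "x - y \<in> Weyl \<Longrightarrow> y \<in> Weyl \<Longrightarrow> x \<in> Weyl"
  using weyl_ncs_add[of "x - y" d \<Omega> y] by simp

text \<open>Each occurrence of \<open>i\<close> absorbs at most one derivative and the other letters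
  absorb none, so a derivative is left over to act on 1.\<close>

lemma ddiv_lword_above:
  assumes y: "dual_to i y"
  shows "set w \<subseteq> {..<d} \<Longrightarrow> count_list w i < m \<Longrightarrow> ddiv y m (lword w) \<in> Weyl"
proof (induction w arbitrary: m)
  case Nil
  then obtain k where "m = Suc k" by (cases m) auto
  then show ?case by (simp add: ddiv_1 weyl_ncs_0)
next
  case (Cons j w)
  then obtain k where m: "m = Suc k" by (cases m) auto
  have j: "j < d" and w: "set w \<subseteq> {..<d}" using Cons by auto
  have "lgen j * ddiv y (Suc k) (lword w) \<in> Weyl"
    using Cons j by (intro Weyl_mult_lgen Cons.IH) (auto simp: m split: if_splits)
  moreover have "(if j = i then ddiv y k (lword w) else 0) \<in> Weyl"
    using Cons by (auto simp: m weyl_ncs_0)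
  ultimately show ?case unfolding m lword_Cons
    using Weyl_cong[OF ddiv_lgen_mult[OF y j lword_free[OF w]]] by (blast intro: weyl_ncs_add)
qed

text \<open>Every derivative has to fall on an \<open>i\<close> and every \<open>i\<close> has to
  absorb one. The m! ways to do so are cancelled by the factorial, so the coefficient is exactly 1
  and survives reduction modulo \<open>\<pi>\<close>.\<close>

lemma ddiv_lword_count:
  assumes y: "dual_to i y"
  shows "set w \<subseteq> {..<d} \<Longrightarrow> ddiv y (count_list w i) (lword w) - lword (filter (\<lambda>j. j \<noteq> i) w) \<in> Weyl"
proof (induction w)
  case Nil
  then show ?case by (simp add: weyl_ncs_0)
next
  case (Cons j w)
  have j: "j < d" and w: "set w \<subseteq> {..<d}" using Cons by auto
  note L = ddiv_lgen_mult[OF y j lword_free[OF w]]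
  show ?case
  proof (cases "j = i")
    case True
    let ?m = "count_list w i"
    have "lgen j * ddiv y (Suc ?m) (lword w) \<in> Weyl"
      by (rule Weyl_mult_lgen[OF j ddiv_lword_above[OF y w]]) simp
    then have "ddiv y (Suc ?m) (lgen j * lword w) - ddiv y ?m (lword w) \<in> Weyl"
      using weyl_ncs_add[OF L[of ?m]] True by fastforce
    from Weyl_trans[OF this Cons.IH[OF w]] True show ?thesis by (simp add: lword_Cons)
  next
    case False
    have IH: "lgen j * (ddiv y (count_list w i) (lword w) - lword (filter (\<lambda>j. j \<noteq> i) w)) \<in> Weyl"
      using Cons by (intro Weyl_mult_lgen) auto
    show ?thesis
    proof (cases "count_list w i")
      case 0
      then show ?thesis using IH False by (simp add: lword_Cons right_diff_distrib)
    next
      case (Suc k)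
      have "ddiv y (Suc k) (lgen j * lword w) - lgen j * ddiv y (Suc k) (lword w) \<in> Weyl"
        using L[of k] False by simp
      then have "ddiv y (Suc k) (lgen j * lword w) - lgen j * lword (filter (\<lambda>j. j \<noteq> i) w) \<in> Weyl"
      proof (rule Weyl_trans)
        show "lgen j * ddiv y (Suc k) (lword w) - lgen j * lword (filter (\<lambda>j. j \<noteq> i) w) \<in> Weyl"
          using IH Suc by (simp add: right_diff_distrib)
      qed
      then show ?thesis using Suc False by (simp add: lword_Cons)
    qed
  qed
qed

text \<open>The recursion of \<open>ddiv_lgen_mult\<close> has coefficients 0 and 1, so the
  denominators in \<open>y\<close> and in 1/m! never reach the result.\<close>

lemma ddiv_lword_Pw:
  assumes y: "dual_to i y"
  shows "set w \<subseteq> {..<d} \<Longrightarrow> ddiv y m (lword w) \<in> Pw 0"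
proof (induction w arbitrary: m)
  case Nil
  then show ?case by (cases m) (auto simp: ddiv_1 P_one P_zero)
next
  case (Cons j w)
  have j: "j < d" and w: "set w \<subseteq> {..<d}" using Cons by auto
  show ?case
  proof (cases m)
    case 0
    then show ?thesis using Cons by (simp add: Pw_of_Lat lword_in_Lat)
  next
    case (Suc k)
    have "lgen j * ddiv y (Suc k) (lword w) + (if j = i then ddiv y k (lword w) else 0) \<in> Pw 0"
      using Cons.IH[OF w] Pw_of_Lat[OF Lat_gen[OF j]] by (auto intro: P_add P_mult0 P_zero)
    from P_add[OF Pw_of_Weyl[OF ddiv_lgen_mult[OF y j lword_free[OF w], of k]] this]
    show ?thesis by (simp only: Suc lword_Cons diff_add_cancel)
  qed
qed

lemma ddiv_sspan:
  assumes y: "dual_to i y" shows "x \<in> sspan l \<Longrightarrow> ddiv y m x \<in> Pw 0"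
proof (induction rule: sspan.induct)
  case (weyl b)
  then show ?case using y by (auto simp: dual_to_def intro: Pw_of_Weyl ddiv_weyl)
next
  case (step r w x)
  then have "nc_const r * ddiv y m (lword w) \<in> Pw 0"
    by (intro P_mult0 ddiv_lword_Pw[OF y] Pw_of_Lat Lat_const) (auto simp: sorted_words_def)
  then show ?case using step by (simp add: ddiv_add ddiv_const_mult P_add)
qed

lemma ddiv_Pw:
  assumes y: "dual_to i y" and x: "x \<in> Pw a" shows "ddiv y m x \<in> Pw a"
proof -
  obtain f b where fb: "f \<in> Lat" "b \<in> Weyl" "x = nc_const (\<pi> ^ a) * f + b"
    using x unfolding Pw_iff by blast
  obtain l where "f \<in> sspan l" using Lat_sspan[OF fb(1)] ..
  then have "nc_const (\<pi> ^ a) * ddiv y m f \<in> Pw (0 + a)"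
    unfolding P_shift by (rule ddiv_sspan[OF y])
  moreover have "ddiv y m b \<in> Pw a"
    using y fb by (auto simp: dual_to_def intro: Pw_of_Weyl ddiv_weyl)
  ultimately show ?thesis unfolding fb(3) by (simp add: ddiv_add ddiv_const_mult P_add)
qed

text \<open>Every word becomes integral after multiplication by a power of \<open>\<pi>\<close>.
  This admits the elements \<open>y\<close> of \<open>dual_to\<close> as multipliers of ideals
  although they may lie outside the lattice.\<close>

lemma Cseq_const_free: "x \<in> free_ncs d \<Longrightarrow> (\<lambda>_. x) \<in> Cseq"
proof (induction rule: free_ncs_induct)
  case zero
  then show ?case using Cseq_0 by (simp add: zero_fun_def)
next
  case (add c w x)
  have "(\<lambda>_. lword w) \<in> Cseq"
    using add Cseq_const[of 0 "lword w"] by (simp add: Pw_of_Lat lword_in_Lat)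
  then have "(\<lambda>_. nc_const (c * inverse (\<pi> ^ (n * length w)))) * (\<lambda>_. lword w) + (\<lambda>_. x) \<in> Cseq"
    using add by (intro Cseq_add Cseq_mult Cseq_sc)
  moreover have "(\<lambda>_. nc_const (c * inverse (\<pi> ^ (n * length w)))) * (\<lambda>_. lword w) + (\<lambda>_. x)
      = (\<lambda>_::nat. nc_const c * nc_word w + x)"
    using pi_nonzero by (simp add: fun_eq_iff lword_def mult.assoc nc_const_mult sc_inverse)
  ultimately show ?case by simp
qed

section \<open>Simplicity\<close>

text \<open>Lets a word be recovered from the number of its letters \<open>i\<close> and what
  remains after deleting them, which makes the deletion injective on words of equal degree in
  \<open>i\<close>.\<close>

lemma sorted_word_eq_replicate:
  "sorted w \<Longrightarrow> set w \<subseteq> {i..} \<Longrightarrow> w = replicate (count_list w i) i @ filter (\<lambda>j. j \<noteq> i) w" for i :: nat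
proof (induction w)
  case (Cons j w)
  show ?case
  proof (cases "j = i")
    case False
    with Cons.prems have "\<forall>k\<in>set (j # w). k \<noteq> i" by auto
    then have "count_list (j # w) i = 0" "filter (\<lambda>j. j \<noteq> i) (j # w) = j # w"
      by (auto simp: count_list_0_iff simp del: filter.simps intro: filter_True)
    then show ?thesis by simp
  qed (use Cons in auto)
qed simp

text \<open>The invariant once the variables below \<open>i\<close> have been removed. A single
  finite combination serves all indices \<open>b\<close>, because the terms of \<open>u\<close>
  agree modulo \<open>Pw 1\<close>.\<close>

definition leading_form :: "nat \<Rightarrow> (nat \<Rightarrow> 'k ncs) \<Rightarrow> nat list set \<Rightarrow> (nat list \<Rightarrow> 'k) \<Rightarrow> bool" where
  "leading_form i u B c \<longleftrightarrow> bseq 0 u \<and> finite B \<and> B \<noteq> {} \<and>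
     (\<forall>w\<in>B. sorted w \<and> set w \<subseteq> {i..<d} \<and> c w \<noteq> 0 \<and> v (c w) = 0) \<and> (\<forall>b. u b - lcomb B c \<in> Pw 1)"

text \<open>With \<open>m\<close> the top degree in the letter \<open>i\<close>, the divided power
  of order \<open>m\<close> kills the words of smaller degree and deletes \<open>i\<close> from the
  others, of which there is at least one. Distinct words stay distinct, so their unit coefficients
  are kept.\<close>

lemma leading_form_Suc:
  assumes B: "leading_form i u B c" and y: "dual_to i y"
  obtains m B' c' where "leading_form (Suc i) (\<lambda>b. ddiv y m (u b)) B' c'"
proof -
  define m where "m = Max ((\<lambda>w. count_list w i) ` B)"
  define B1 where "B1 = {w \<in> B. count_list w i = m}"
  define \<phi> where "\<phi> = filter (\<lambda>j. j \<noteq> i)"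
  \<comment> \<open>For \<open>w\<close> obtained by deletion, this is the coefficient of the one
    top-degree word that it comes from.\<close>
  define c' where "c' w = c (replicate m i @ w)" for w
  have fin: "finite B" "B \<noteq> {}"
    and Bw: "\<And>w. w \<in> B \<Longrightarrow> sorted w \<and> set w \<subseteq> {i..<d} \<and> c w \<noteq> 0 \<and> v (c w) = 0"
    and u0: "bseq 0 u" and u: "\<And>b. u b - lcomb B c \<in> Pw 1"
    using B by (auto simp: leading_form_def)
  have set: "set w \<subseteq> {..<d}" if "w \<in> B" for w
    using Bw[OF that] by auto
  have le: "count_list w i \<le> m" if "w \<in> B" for w using fin that by (simp add: m_def)
  have "m \<in> (\<lambda>w. count_list w i) ` B" unfolding m_def using fin by (intro Max_in) auto
  then have ne: "B1 \<noteq> {}" by (auto simp: B1_def)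
  have fin1: "finite (\<phi> ` B1)" using fin by (simp add: B1_def)
  have eq: "w = replicate m i @ \<phi> w" if "w \<in> B1" for w
  proof -
    have w: "w \<in> B" "count_list w i = m" using that by (auto simp: B1_def)
    then have "set w \<subseteq> {i..}" using Bw[of w] by auto
    then show ?thesis using sorted_word_eq_replicate[of w i] Bw[OF w(1)] w(2) by (simp add: \<phi>_def)
  qed
  then have inj: "inj_on \<phi> B1" by (metis inj_onI)
  have c'c: "c' (\<phi> w) = c w" if "w \<in> B1" for w using eq[OF that] by (simp add: c'_def)
  have comb: "ddiv y m (lcomb B c) - lcomb (\<phi> ` B1) c' \<in> Weyl"
  proof -
    have "lcomb (\<phi> ` B1) c' = (\<Sum>w\<in>B1. nc_const (c w) * lword (\<phi> w))"
      unfolding lcomb_def by (simp add: sum.reindex[OF inj] c'c)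
    also have "\<dots> = (\<Sum>w\<in>B. nc_const (c w) * (if count_list w i = m then lword (\<phi> w) else 0))"
      unfolding B1_def using fin(1) by (intro sum.mono_neutral_cong_left) auto
    finally have "ddiv y m (lcomb B c) - lcomb (\<phi> ` B1) c'
        = (\<Sum>w\<in>B. nc_const (c w) * (ddiv y m (lword w) - (if count_list w i = m then lword (\<phi> w) else 0)))"
      by (simp add: lcomb_def ddiv_sum ddiv_const_mult sum_subtractf right_diff_distrib)
    also have "\<dots> \<in> Weyl"
    proof (intro weyl_ncs_sum weyl_ncs_const_mult)
      fix w assume w: "w \<in> B"
      show "ddiv y m (lword w) - (if count_list w i = m then lword (\<phi> w) else 0) \<in> Weyl"
        using ddiv_lword_count[OF y set[OF w]] ddiv_lword_above[OF y set[OF w], of m] le[OF w]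
        by (auto simp: \<phi>_def)
    qed
    finally show ?thesis .
  qed
  have "ddiv y m (u b) - lcomb (\<phi> ` B1) c' \<in> Pw 1" for b
    using P_add[OF ddiv_Pw[OF y u[of b], of m] Pw_of_Weyl[OF comb]] by (simp add: ddiv_diff)
  moreover have "bseq 0 (\<lambda>b. ddiv y m (u b))"
    using u0 ddiv_Pw[OF y] by (simp add: bseq_def sc_1 ddiv_diff[symmetric])
  moreover have "sorted (\<phi> w) \<and> set (\<phi> w) \<subseteq> {Suc i..<d} \<and> c' (\<phi> w) \<noteq> 0 \<and> v (c' (\<phi> w)) = 0"
    if w: "w \<in> B1" for w
  proof -
    have "w \<in> B" using w by (simp add: B1_def)
    have "\<And>x. x \<in> set (\<phi> w) \<Longrightarrow> x \<noteq> i \<and> x \<in> set w" by (simp add: \<phi>_def)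
    then have "set (\<phi> w) \<subseteq> {Suc i..<d}" using Bw[OF \<open>w \<in> B\<close>] by fastforce
    moreover have "sorted (\<phi> w)" using Bw[OF \<open>w \<in> B\<close>] by (simp add: \<phi>_def sorted_wrt_filter)
    ultimately show ?thesis using Bw[OF \<open>w \<in> B\<close>] by (simp add: c'c[OF w])
  qed
  ultimately have "leading_form (Suc i) (\<lambda>b. ddiv y m (u b)) (\<phi> ` B1) c'"
    using fin1 ne unfolding leading_form_def by blast
  then show thesis by (rule that)
qed

lemma one_mem_ideal:
  assumes dual: "\<And>i. i < d \<Longrightarrow> \<exists>y. dual_to i y"
    and J_sub: "J \<subseteq> Cseq" and ZJ: "Zseq \<subseteq> J"
    and J_add: "\<And>x y. x \<in> J \<Longrightarrow> y \<in> J \<Longrightarrow> x + y \<in> J"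
    and J_left: "\<And>x y. x \<in> Cseq \<Longrightarrow> y \<in> J \<Longrightarrow> x * y \<in> J"
    and J_right: "\<And>x y. x \<in> Cseq \<Longrightarrow> y \<in> J \<Longrightarrow> y * x \<in> J"
    and u: "u \<in> J" "u \<notin> Zseq"
  shows "1 \<in> J"
proof -
  have J_scale: "(\<lambda>b. nc_const c * x b) \<in> J" if "x \<in> J" for c x
    using J_left[OF Cseq_sc that, of c] by (simp add: func_times)
  have J_ddiv: "(\<lambda>b. ddiv y m (x b)) \<in> J" if x: "x \<in> J" and y: "y \<in> free_ncs d" for x y m
  proof (induction m)
    case (Suc m)
    let ?z = "\<lambda>b. ddiv y m (x b)"
    \<comment> \<open>The commutator of \<open>y\<close> with the previous divided power, its minus
      sign written as the scalar -1 because the closure properties given for \<open>J\<close> are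
      sums and multiples.\<close>
    have "(\<lambda>_. y) * ?z + (\<lambda>b. nc_const (- 1) * (?z * (\<lambda>_. y)) b) \<in> J"
      using Suc y by (intro J_add J_left J_scale J_right Cseq_const_free)
    from J_scale[OF this, of "inverse (of_nat (Suc m))"]
    show ?case by (simp add: ddiv.simps(2) nc_const_uminus del: of_nat_Suc)
  qed (use x in simp)
  obtain u0 e f where u0: "bseq 0 u0" "u0 - (\<lambda>_. nc_const e) * u \<in> Zseq"
    "f \<in> Pw 0" "f \<notin> Pw 1" "\<And>b. u0 b - f \<in> Pw 1"
    by (rule normalise[of u]) (use u J_sub in auto)
  have "u0 - (\<lambda>_. nc_const e) * u + (\<lambda>_. nc_const e) * u \<in> J"
    using u0(2) ZJ u(1) by (intro J_add J_left Cseq_sc) auto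
  then have u0J: "u0 \<in> J" by simp
  obtain B0 c0 where B0: "finite B0" "B0 \<noteq> {}" "B0 \<subseteq> sorted_words"
    "\<forall>w\<in>B0. c0 w \<noteq> 0 \<and> v (c0 w) = 0" "f - lcomb B0 c0 \<in> Pw 1"
    by (rule unit_lcomb[OF u0(3,4)]) (erule (4) that)
  have "u0 b - lcomb B0 c0 \<in> Pw 1" for b
    using P_add[OF u0(5)[of b] B0(5)] by simp
  then have init: "leading_form 0 u0 B0 c0"
    using B0(1-4) u0(1) unfolding leading_form_def sorted_words_def atLeast0LessThan by blast
  have "i \<le> d \<Longrightarrow> \<exists>w\<in>J. \<exists>B c. leading_form i w B c" for i
  proof (induction i)
    case 0
    then show ?case using init u0J by blast
  next
    case (Suc i)
    then obtain w B c where w: "w \<in> J" "leading_form i w B c" by auto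
    obtain y where y: "dual_to i y" using dual[of i] Suc by auto
    then have "y \<in> free_ncs d" by (simp add: dual_to_def)
    obtain m B' c' where "leading_form (Suc i) (\<lambda>b. ddiv y m (w b)) B' c'"
      by (rule leading_form_Suc[OF w(2) y])
    then show ?case using J_ddiv[OF w(1) \<open>y \<in> free_ncs d\<close>, of m] by blast
  qed
  then obtain w B c where w: "w \<in> J" "leading_form d w B c" by blast
  \<comment> \<open>At stage \<open>d\<close> no letter is left, so the combination is a single unit
    scalar.\<close>
  have "B \<subseteq> {[]}" "B \<noteq> {}" using w(2) by (auto simp: leading_form_def)
  then have "B = {[]}" using subset_singletonD by metis
  then have B: "bseq 0 w" "c [] \<noteq> 0" "v (c []) = 0" "\<And>b. w b - nc_const (c []) \<in> Pw 1"
    using w(2) by (auto simp: leading_form_def lcomb_def)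
  have "nc_const (inverse (c [])) \<in> Pw 0"
    by (rule Pw_of_Lat[OF Lat_const[OF R_unit_inverse[OF B(2,3)]]])
  from one_mem_if_unit_mod_P1[OF J_sub ZJ J_add J_left w(1) B(1,4,2) this] show ?thesis .
qed

end

section \<open>From the form on vectors to its Gram matrix\<close>

lemma bform_unit_vectors:
  assumes "k < d" "l < d"
  shows "bform d \<Omega> (\<lambda>i. if i = k then a else 0) (\<lambda>j. if j = l then b else 0) = a * \<Omega> k l * b"
  using assms unfolding bform_def
  by (simp add: if_distrib[where f="\<lambda>x. x * _"] if_distrib[where f="\<lambda>x. _ * x"] cong: if_cong)

lemma bform_add:
  "bform d \<Omega> (\<lambda>i. x i + y i) z = bform d \<Omega> x z + bform d \<Omega> y z"
  "bform d \<Omega> z (\<lambda>i. x i + y i) = bform d \<Omega> z x + bform d \<Omega> z y"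
  by (simp_all add: bform_def distrib_left distrib_right sum.distrib)

theorem theorem7p3:
  fixes v :: "'k::field_char_0 \<Rightarrow> int" and \<pi> :: 'k
    and d n :: nat and \<Omega> :: "nat \<Rightarrow> nat \<Rightarrow> 'k"
  assumes "complete_dvr v \<pi>"
    and "symplectic v \<pi> d \<Omega>"
  shows "simple_ring (affinoid_weyl v \<pi> d \<Omega> n)"
proof -
  have int: "\<forall>i<d. \<forall>j<d. \<Omega> i j \<in> val_ring v"
    and alt: "\<forall>x. bform d \<Omega> x x = 0"
    and nondeg: "\<forall>x. (\<exists>i<d. x i \<noteq> 0) \<longrightarrow> (\<exists>y. bform d \<Omega> x y \<noteq> 0)"
    using assms(2)[unfolded symplectic_def] by simp_all
  define e where "e k = (\<lambda>i. if i = k then 1 else (0::'k))" for k :: nat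
  have be: "bform d \<Omega> (e k) (e l) = \<Omega> k l" if "k < d" "l < d" for k l
    using bform_unit_vectors[OF that, of \<Omega> 1 1] by (simp add: e_def)
  interpret alternating_weyl_lattice v \<pi> d n \<Omega>
  proof
    show "complete_dvr v \<pi>" by fact
    show "\<Omega> i j \<in> val_ring v" if "i < d" "j < d" for i j using int that by blast
    show "\<Omega> i i = 0" if "i < d" for i using be[of i i] alt that by simp
    show "\<Omega> j i = - \<Omega> i j" if "i < d" "j < d" for i j
      \<comment> \<open>Polarisation: \<open>e i\<close>, \<open>e j\<close> and their sum all pair
        to 0 with themselves.\<close>
      using alt[rule_format, of "\<lambda>k. e i k + e j k"] be[of i j] be[of j i] that
      by (simp add: bform_add alt add_eq_0_iff)
  qed
  have ker: "x i = 0" if x: "\<And>j. j < d \<Longrightarrow> (\<Sum>k<d. x k * \<Omega> k j) = 0" and i: "i < d" for x i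
  proof (rule ccontr)
    assume "x i \<noteq> 0"
    then obtain z where z: "bform d \<Omega> x z \<noteq> 0" using nondeg i by blast
    have "bform d \<Omega> x z = (\<Sum>j<d. (\<Sum>k<d. x k * \<Omega> k j) * z j)"
      unfolding bform_def by (subst sum.swap) (simp add: sum_distrib_right)
    also have "\<dots> = 0" using x by simp
    finally show False using z by simp
  qed
  have "\<exists>y. dual_to i y" if i: "i < d" for i
  proof -
    obtain c where "\<And>j. j < d \<Longrightarrow> (\<Sum>k<d. c k * \<Omega> k j) = (if j = i then 1 else 0)"
      using dual_vector_exists[where \<Omega> = \<Omega> and d = d and i = i] ker i by blast
    from dual_toI[OF this] show ?thesis ..
  qed
  then show ?thesis
    by (intro simple_ring_AW[OF one_notin_Zseq] one_mem_ideal)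
qed

end
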